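(* Consider the infinite-horizon constrained problem $$\min_{\{\boldsymbol\delta_{1:\mathsf T},D_{\mathsf T},\mathsf T\}}\ \mathbb E\,\mathsf T\quad\text{subject to}\quad \mathbb P_0(D_{\mathsf T}=1)\le\alpha,\quad \mathbb P_1(D_{\mathsf T}=0)\le\beta,\quad \mathbb E\Big(\sum_{t=1}^{\mathsf T}\mathbb 1_{\{\delta_t=\ell\}}\Big)\le T^\ell\ \ (\ell\in\Omega),$$ and let $\{\boldsymbol\delta^\star_{1:\mathsf T^\star},D^\star_{\mathsf T^\star},\mathsf T^\star\}$ be its optimal procedure, with effective constraint set $\Omega_c$ and stopping thresholds $-A,B$, as described in the context. Based on Wald's approximation (i.e., $L_{\mathsf T^\star}\approx -A$ given $D^\star_{\mathsf T^\star}=0$, or $L_{\mathsf T^\star}\approx B$ given $D^\star_{\mathsf T^\star}=1$), the expected sample size of the optimal procedure is lower bounded by $$\mathbb E\,\mathsf T^\star\ \ge\ \pi_0\frac{\mathcal D(\alpha\|1-\beta)}{\max_{j\in\overline\Omega_c}\mathcal D_0^j}+\pi_1\frac{\mathcal D(1-\beta\|\alpha)}{\max_{j\in\overline\Omega_c}\mathcal D_1^j}-\sum_{\ell\in\Omega_c}\left(\max\left\{\frac{\mathcal D_1^\ell}{\max_{j\in\overline\Omega_c}\mathcal D_1^j},\frac{\mathcal D_0^\ell}{\max_{j\in\overline\Omega_c}\mathcal D_0^j}\right\}-1\right)T^\ell,$$ where $\overline\Omega_c=\Pi\setminus\Omega_c$ contains all sensors except those in $\Omega_c$.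
   Context: Model. There are $K$ sensors, $\Pi=\{1,\dots,K\}$, and a binary hypothesis $\mathcal H\in\{0,1\}$ with prior $\mathbb P(\mathcal H=i)=\pi_i$, $i=0,1$. Sensor $\ell$ produces samples with known density $f_i^\ell$ under $\mathcal H=i$; no two sensors have identical pairs $(f_0^\ell,f_1^\ell)$. Samples are i.i.d. over time for each sensor and independent across sensors, given $\mathcal H$. At each time $t$ exactly one sensor $\delta_t\in\Pi$ is selected as a function of $X_1,\dots,X_{t-1}$, and the sample $X_t$ is then drawn from $f_i^{\delta_t}$ under $\mathcal H=i$. $\Omega\subseteq\Pi$ is the set of usage-constrained sensors and $T^\ell\in\mathbb R^+$ are their usage limits. A procedure $\{\boldsymbol\delta_{1:\mathsf T},D_{\mathsf T},\mathsf T\}$ consists of the selections $\boldsymbol\delta_{1:\mathsf T}=(\delta_1,\dots,\delta_{\mathsf T})$; a deterministic stopping rule $\mathsf T$ (whether $\mathsf T=t$ is determined by $X_1,\dots,X_t$), with no upper bound imposed on $\mathsf T$; and a decision $D_{\mathsf T}\in\{0,1\}$ which on $\{\mathsf T=t\}$ is a function of $X_1,\dots,X_t$. $\mathbb P,\mathbb E$ refer to the joint law of $\mathcal H$ and the samples; $\mathbb P_i,\mathbb E_i$ to the law conditioned on $\mathcal H=i$. Log-likelihood ratio: $L_n=\sum_{t=1}^n\log\frac{f_1^{\delta_t}(X_t)}{f_0^{\delta_t}(X_t)}$, $L_0=0$. Optimal procedure. It is the procedure minimizing $\mathbb E\,\mathsf T+\mu_0\pi_0\mathbb P_0(D_{\mathsf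 T}=1)+\mu_1\pi_1\mathbb P_1(D_{\mathsf T}=0)+\sum_{\ell\in\Omega}\lambda_\ell\mathbb E(\sum_{t=1}^{\mathsf T}\mathbb 1_{\{\delta_t=\ell\}})$ over all procedures, where the multipliers $\mu_0,\mu_1\ge0$ and $\lambda_\ell\ge0$ ($\ell\in\Omega$) are chosen such that the two error-probability constraints are satisfied with equality, all usage constraints are satisfied, and the usage constraints for the sensors in $\Omega_c=\{\ell:\lambda_\ell>0\}$ (the effective set) are satisfied with equality. It has the form $\delta^\star_{t+1}=\psi(L_t)$, $\mathsf T^\star=\min\{t:L_t\notin(-A,B)\}$, $D^\star_{\mathsf T^\star}=0$ if $L_{\mathsf T^\star}\le-A$ and $D^\star_{\mathsf T^\star}=1$ if $L_{\mathsf T^\star}\ge B$, with a time-invariant function $\psi$ and constants $A,B$. Divergences. The Kullback–Leibler divergences of sensor $\ell$ are $\mathcal D_0^\ell=\mathbb E_0\big(\log\frac{f_0^\ell(X)}{f_1^\ell(X)}\big)$ and $\mathcal D_1^\ell=\mathbb E_1\big(\log\frac{f_1^\ell(X)}{f_0^\ell(X)}\big)$, with $X$ a sample from sensor $\ell$ (so $X\sim f_i^\ell$ under $\mathbb E_i$). $\mathcal D(p\|q)=p\log\frac pq+(1-p)\log\frac{1-p}{1-q}$ is the Kullback–Leibler divergence of binary distributions. *)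

theory Defs
  imports "HOL-Probability.Probability"
begin

text \<open>
  All samples live on one probability space carrying the hypothesis and an array of potential
  samples: \<open>samples S l t\<close> is the sample sensor \<open>l\<close> delivers if it is selected at time \<open>t \<ge> 1\<close>.
  Only the entries of the selected sensors are ever observed. Densities are taken with respect to
  a common reference measure \<open>base S\<close>; the first argument of \<open>dens S\<close> is the hypothesis.
\<close>

record ('w, 'a) sensing =
  law :: "'w measure"
  hyp :: "'w \<Rightarrow> nat"
  samples :: "nat \<Rightarrow> nat \<Rightarrow> 'w \<Rightarrow> 'a"
  num_sensors :: nat
  prior :: "nat \<Rightarrow> real"
  base :: "'a measure"
  dens :: "nat \<Rightarrow> nat \<Rightarrow> 'a \<Rightarrow> real"

definition sensors :: "('w, 'a) sensing \<Rightarrow> nat set" where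
  "sensors S = {1..num_sensors S}"

definition cond_law :: "('w, 'a) sensing \<Rightarrow> nat \<Rightarrow> 'w measure" where
  "cond_law S i = uniform_measure (law S) {\<omega> \<in> space (law S). hyp S \<omega> = i}"

definition sample_law :: "('w, 'a) sensing \<Rightarrow> nat \<Rightarrow> nat \<Rightarrow> 'a measure" where
  "sample_law S i l = density (base S) (\<lambda>x. ennreal (dens S i l x))"

definition sensing_model :: "('w, 'a) sensing \<Rightarrow> bool" where
  "sensing_model S \<longleftrightarrow>
     prob_space (law S) \<and>
     hyp S \<in> measurable (law S) (count_space {0, 1}) \<and>
     (\<forall>i\<in>{0, 1}. 0 < prior S i \<and>
        measure (law S) {\<omega> \<in> space (law S). hyp S \<omega> = i} = prior S i) \<and>
     sigma_finite_measure (base S) \<and>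
     (\<forall>i\<in>{0, 1}. \<forall>l\<in>sensors S. \<forall>x\<in>space (base S). 0 \<le> dens S i l x) \<and>
     (\<forall>i\<in>{0, 1}. \<forall>l\<in>sensors S. \<forall>t\<ge>1.
        distributed (cond_law S i) (base S) (samples S l t) (\<lambda>x. ennreal (dens S i l x))) \<and>
     (\<forall>i\<in>{0, 1}. prob_space.indep_vars (cond_law S i) (\<lambda>_. base S)
        (\<lambda>(l, t). samples S l t) (sensors S \<times> {1..})) \<and>
     inj_on (\<lambda>l. (dens S 0 l, dens S 1 l)) (sensors S)"

definition kl0 :: "('w, 'a) sensing \<Rightarrow> nat \<Rightarrow> real" where
  "kl0 S l = (\<integral>x. ln (dens S 0 l x / dens S 1 l x) \<partial>sample_law S 0 l)"

definition kl1 :: "('w, 'a) sensing \<Rightarrow> nat \<Rightarrow> real" where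
  "kl1 S l = (\<integral>x. ln (dens S 1 l x / dens S 0 l x) \<partial>sample_law S 1 l)"

text \<open>
  Both divergences of every sensor are finite. Since \<open>ln 0 = 0\<close> and the Bochner integral of a
  non-integrable function is \<open>0\<close>, finiteness has to be expressed by mutual absolute continuity
  together with integrability of the log-likelihood ratio.
\<close>

definition finite_divergences :: "('w, 'a) sensing \<Rightarrow> bool" where
  "finite_divergences S \<longleftrightarrow> (\<forall>l\<in>sensors S.
     (AE x in base S. dens S 0 l x = 0 \<longleftrightarrow> dens S 1 l x = 0) \<and>
     integrable (sample_law S 0 l) (\<lambda>x. ln (dens S 0 l x / dens S 1 l x)) \<and>
     integrable (sample_law S 1 l) (\<lambda>x. ln (dens S 1 l x / dens S 0 l x)))"

definition binary_kl :: "real \<Rightarrow> real \<Rightarrow> real" where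
  "binary_kl p q = p * ln (p / q) + (1 - p) * ln ((1 - p) / (1 - q))"

text \<open>
  A procedure consists of functions of the observed samples: \<open>sel p t\<close> takes \<open>X\<^sub>1, \<dots>, X\<^sub>t\<^sub>-\<^sub>1\<close> and
  gives the sensor used at time \<open>t \<ge> 1\<close>, while \<open>halt p t\<close> and \<open>dec p t\<close> take \<open>X\<^sub>1, \<dots>, X\<^sub>t\<close>.
  Stopping occurs at the first \<open>t\<close> at which \<open>halt p t\<close> holds, so it is unbounded and possibly
  infinite; \<open>t = 0\<close> (no sample at all) is allowed.
\<close>

record 'a procedure =
  sel :: "nat \<Rightarrow> (nat \<Rightarrow> 'a) \<Rightarrow> nat"
  halt :: "nat \<Rightarrow> (nat \<Rightarrow> 'a) \<Rightarrow> bool"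
  dec :: "nat \<Rightarrow> (nat \<Rightarrow> 'a) \<Rightarrow> nat"

definition is_procedure :: "('w, 'a) sensing \<Rightarrow> 'a procedure \<Rightarrow> bool" where
  "is_procedure S p \<longleftrightarrow>
     (\<forall>t\<ge>1. sel p t \<in> measurable (PiM {1..<t} (\<lambda>_. base S)) (count_space (sensors S))) \<and>
     (\<forall>t. halt p t \<in> measurable (PiM {1..t} (\<lambda>_. base S)) (count_space UNIV)) \<and>
     (\<forall>t. dec p t \<in> measurable (PiM {1..t} (\<lambda>_. base S)) (count_space {0, 1}))"

text \<open>
  \<open>history S p t \<omega>\<close> is the family \<open>X\<^sub>1, \<dots>, X\<^sub>t\<close> of observed samples, as an element of the product
  space over \<open>{1..t}\<close> (hence \<open>undefined\<close> outside this index set).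
\<close>

primrec history :: "('w, 'a) sensing \<Rightarrow> 'a procedure \<Rightarrow> nat \<Rightarrow> 'w \<Rightarrow> nat \<Rightarrow> 'a" where
  "history S p 0 \<omega> = (\<lambda>_. undefined)"
| "history S p (Suc t) \<omega> =
     (history S p t \<omega>)(Suc t := samples S (sel p (Suc t) (history S p t \<omega>)) (Suc t) \<omega>)"

definition selected :: "('w, 'a) sensing \<Rightarrow> 'a procedure \<Rightarrow> nat \<Rightarrow> 'w \<Rightarrow> nat" where
  "selected S p t \<omega> = sel p t (history S p (t - 1) \<omega>)"

definition observed :: "('w, 'a) sensing \<Rightarrow> 'a procedure \<Rightarrow> nat \<Rightarrow> 'w \<Rightarrow> 'a" where
  "observed S p t \<omega> = samples S (selected S p t \<omega>) t \<omega>"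

definition stop_time :: "('w, 'a) sensing \<Rightarrow> 'a procedure \<Rightarrow> 'w \<Rightarrow> enat" where
  "stop_time S p \<omega> = Inf (enat ` {t. halt p t (history S p t \<omega>)})"

text \<open>Only meaningful where the stopping time is finite, since \<open>the_enat \<infinity>\<close> is unspecified.\<close>

definition decision :: "('w, 'a) sensing \<Rightarrow> 'a procedure \<Rightarrow> 'w \<Rightarrow> nat" where
  "decision S p \<omega> =
     (let n = the_enat (stop_time S p \<omega>) in dec p n (history S p n \<omega>))"

definition llr :: "('w, 'a) sensing \<Rightarrow> 'a procedure \<Rightarrow> nat \<Rightarrow> 'w \<Rightarrow> real" where
  "llr S p n \<omega> = (\<Sum>t = 1..n.
     ln (dens S 1 (selected S p t \<omega>) (observed S p t \<omega>) /
         dens S 0 (selected S p t \<omega>) (observed S p t \<omega>)))"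

definition expected_time :: "('w, 'a) sensing \<Rightarrow> 'a procedure \<Rightarrow> ennreal" where
  "expected_time S p = (\<integral>\<^sup>+\<omega>. ennreal_of_enat (stop_time S p \<omega>) \<partial>law S)"

definition expected_usage :: "('w, 'a) sensing \<Rightarrow> 'a procedure \<Rightarrow> nat \<Rightarrow> ennreal" where
  "expected_usage S p l = (\<integral>\<^sup>+\<omega>.
     (\<Sum>t. if enat (Suc t) \<le> stop_time S p \<omega> \<and> selected S p (Suc t) \<omega> = l then 1 else 0) \<partial>law S)"

definition decide_prob :: "('w, 'a) sensing \<Rightarrow> 'a procedure \<Rightarrow> nat \<Rightarrow> nat \<Rightarrow> real" where
  "decide_prob S p i d =
     measure (cond_law S i) {\<omega> \<in> space (law S). stop_time S p \<omega> < \<infinity> \<and> decision S p \<omega> = d}"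

definition feasible ::
  "('w, 'a) sensing \<Rightarrow> real \<Rightarrow> real \<Rightarrow> nat set \<Rightarrow> (nat \<Rightarrow> real) \<Rightarrow> 'a procedure \<Rightarrow> bool" where
  "feasible S \<alpha> \<beta> \<Omega> Tlim p \<longleftrightarrow>
     is_procedure S p \<and> decide_prob S p 0 1 \<le> \<alpha> \<and> decide_prob S p 1 0 \<le> \<beta> \<and>
     (\<forall>l\<in>\<Omega>. expected_usage S p l \<le> ennreal (Tlim l))"

definition constrained_optimal ::
  "('w, 'a) sensing \<Rightarrow> real \<Rightarrow> real \<Rightarrow> nat set \<Rightarrow> (nat \<Rightarrow> real) \<Rightarrow> 'a procedure \<Rightarrow> bool" where
  "constrained_optimal S \<alpha> \<beta> \<Omega> Tlim p \<longleftrightarrow>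
     feasible S \<alpha> \<beta> \<Omega> Tlim p \<and>
     (\<forall>q. feasible S \<alpha> \<beta> \<Omega> Tlim q \<longrightarrow> expected_time S p \<le> expected_time S q)"

definition lagrangian ::
  "('w, 'a) sensing \<Rightarrow> nat set \<Rightarrow> real \<Rightarrow> real \<Rightarrow> (nat \<Rightarrow> real) \<Rightarrow> 'a procedure \<Rightarrow> ennreal" where
  "lagrangian S \<Omega> \<mu>0 \<mu>1 lam p =
     expected_time S p
     + ennreal (\<mu>0 * prior S 0 * decide_prob S p 0 1)
     + ennreal (\<mu>1 * prior S 1 * decide_prob S p 1 0)
     + (\<Sum>l\<in>\<Omega>. ennreal (lam l) * expected_usage S p l)"

definition effective_set :: "nat set \<Rightarrow> (nat \<Rightarrow> real) \<Rightarrow> nat set" where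
  "effective_set \<Omega> lam = {l \<in> \<Omega>. 0 < lam l}"

definition lagrangian_optimal ::
  "('w, 'a) sensing \<Rightarrow> real \<Rightarrow> real \<Rightarrow> nat set \<Rightarrow> (nat \<Rightarrow> real) \<Rightarrow>
     real \<Rightarrow> real \<Rightarrow> (nat \<Rightarrow> real) \<Rightarrow> 'a procedure \<Rightarrow> bool" where
  "lagrangian_optimal S \<alpha> \<beta> \<Omega> Tlim \<mu>0 \<mu>1 lam p \<longleftrightarrow>
     0 \<le> \<mu>0 \<and> 0 \<le> \<mu>1 \<and> (\<forall>l\<in>\<Omega>. 0 \<le> lam l) \<and>
     is_procedure S p \<and>
     (\<forall>q. is_procedure S q \<longrightarrow> lagrangian S \<Omega> \<mu>0 \<mu>1 lam p \<le> lagrangian S \<Omega> \<mu>0 \<mu>1 lam q) \<and>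
     decide_prob S p 0 1 = \<alpha> \<and> decide_prob S p 1 0 = \<beta> \<and>
     (\<forall>l\<in>\<Omega>. expected_usage S p l \<le> ennreal (Tlim l)) \<and>
     (\<forall>l\<in>effective_set \<Omega> lam. expected_usage S p l = ennreal (Tlim l))"

definition threshold_form ::
  "('w, 'a) sensing \<Rightarrow> (real \<Rightarrow> nat) \<Rightarrow> real \<Rightarrow> real \<Rightarrow> 'a procedure \<Rightarrow> bool" where
  "threshold_form S \<psi> A B p \<longleftrightarrow>
     \<psi> \<in> measurable borel (count_space (sensors S)) \<and>
     (AE \<omega> in law S.
        (\<forall>t. enat t < stop_time S p \<omega> \<longrightarrow> selected S p (Suc t) \<omega> = \<psi> (llr S p t \<omega>)) \<and>
        stop_time S p \<omega> = Inf (enat ` {t. llr S p t \<omega> \<notin> {-A<..<B}}) \<and>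
        (\<forall>n. stop_time S p \<omega> = enat n \<longrightarrow>
           (llr S p n \<omega> \<le> -A \<longrightarrow> decision S p \<omega> = 0) \<and>
           (B \<le> llr S p n \<omega> \<longrightarrow> decision S p \<omega> = 1)))"

text \<open>
  Wald's approximation taken as exact: the overshoot of the log-likelihood ratio over the
  thresholds at the stopping time is zero.
\<close>

definition wald_approximation ::
  "('w, 'a) sensing \<Rightarrow> real \<Rightarrow> real \<Rightarrow> 'a procedure \<Rightarrow> bool" where
  "wald_approximation S A B p \<longleftrightarrow>
     (AE \<omega> in law S. \<forall>n. stop_time S p \<omega> = enat n \<longrightarrow>
        (decision S p \<omega> = 0 \<longrightarrow> llr S p n \<omega> = -A) \<and>
        (decision S p \<omega> = 1 \<longrightarrow> llr S p n \<omega> = B))"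

end

theory Submission
  imports Defs
begin

text \<open>
  With \<open>N\<^sub>i(l)\<close> the expected usage of sensor \<open>l\<close> under hypothesis \<open>i\<close>, Wald's identity gives
  \<open>E\<^sub>1 L\<^sub>T = \<Sum>\<^sub>l N\<^sub>1(l) D\<^sub>1(l)\<close> and \<open>- E\<^sub>0 L\<^sub>T = \<Sum>\<^sub>l N\<^sub>0(l) D\<^sub>0(l)\<close>. Without overshoot, changing the
  measure on the events of deciding \<open>1\<close> and \<open>0\<close> yields \<open>1 - \<beta> = e\<^sup>B \<alpha>\<close> and
  \<open>\<beta> = e\<^sup>-\<^sup>A (1 - \<alpha>)\<close>, so the left-hand sides are the two binary divergences. Dividing by the
  largest divergence \<open>M\<^sub>i\<close> of an unconstrained sensor replaces each unconstrained coefficient by at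
  most \<open>1\<close>; for \<open>l\<close> in the effective set the coefficients \<open>D\<^sub>i(l) / M\<^sub>i\<close> are bounded by their
  maximum over \<open>i\<close>, and \<open>\<pi>\<^sub>0 N\<^sub>0(l) + \<pi>\<^sub>1 N\<^sub>1(l) = T\<^sup>l\<close> by the equality constraint.
\<close>

text \<open>
  The argument \<open>z\<close> is the whole array of potential samples. Independence of the past from the next
  sample is only available for this array, so the history is factored through it.
\<close>

primrec history_of :: "'a procedure \<Rightarrow> nat \<Rightarrow> (nat \<times> nat \<Rightarrow> 'a) \<Rightarrow> nat \<Rightarrow> 'a" where
  "history_of p 0 z = (\<lambda>_. undefined)"
| "history_of p (Suc t) z =
     (history_of p t z)(Suc t := z (sel p (Suc t) (history_of p t z), Suc t))"

lemma insert_Suc_interval: "{1..Suc n} = {1..n} \<union> {Suc n}"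
  by auto

text \<open>Counts a possibly infinite time as a series of indicators, which gives both the
  splitting of the expected sample size by sensors and the measurability of the stopping time. At
  infinity the series of ones diverges to \<open>top\<close>.\<close>

lemma suminf_of_bool_less_enat: "(\<Sum>n. of_bool (enat n < x)) = ennreal_of_enat x"
proof (cases x)
  case (enat k)
  then have "(\<Sum>n. of_bool (enat n < x)) = (\<Sum>n<k. of_bool (enat n < x) :: ennreal)"
    by (intro suminf_finite) auto
  then show ?thesis using enat by simp
next
  case infinity
  have "(\<Sum>n. ennreal 1) = top"
    using summable_suminf_not_top[of "\<lambda>_. 1"] by (auto simp: summable_const_iff)
  then show ?thesis using infinity by simp
qed

section \<open>The model, its conditional laws and total expectation\<close>

locale sensing_procedure =
  fixes S :: "('w, 'a) sensing" and p :: "'a procedure"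
  assumes model: "sensing_model S" and proc: "is_procedure S p"
begin

declare One_nat_def [simp del]

abbreviation hist_space :: "nat \<Rightarrow> (nat \<Rightarrow> 'a) measure" where
  "hist_space n \<equiv> PiM {1..n} (\<lambda>_. base S)"

lemma finite_sensors [simp]: "finite (sensors S)"
  by (simp add: sensors_def)

lemma prob_space_law: "prob_space (law S)"
  using model by (simp add: sensing_model_def)

lemma prior_pos: "i \<in> {0, 1} \<Longrightarrow> 0 < prior S i"
  using model unfolding sensing_model_def by blast

lemma sigma_finite_base: "sigma_finite_measure (base S)"
  using model by (simp add: sensing_model_def)

lemma dens_nonneg: "i \<in> {0, 1} \<Longrightarrow> l \<in> sensors S \<Longrightarrow> x \<in> space (base S) \<Longrightarrow> 0 \<le> dens S i l x"
  using model unfolding sensing_model_def by blast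

lemma distributed_samples:
  "i \<in> {0, 1} \<Longrightarrow> l \<in> sensors S \<Longrightarrow>
    distributed (cond_law S i) (base S) (samples S l (Suc t)) (\<lambda>x. ennreal (dens S i l x))"
  using model unfolding sensing_model_def by (blast intro: Suc_leI[OF zero_less_Suc, folded One_nat_def])

lemma indep_samples:
  "i \<in> {0, 1} \<Longrightarrow> prob_space.indep_vars (cond_law S i) (\<lambda>_. base S)
     (\<lambda>(l, t). samples S l t) (sensors S \<times> {1..})"
  using model unfolding sensing_model_def by blast

lemma space_cond_law [simp]: "space (cond_law S i) = space (law S)"
  and sets_cond_law [simp, measurable_cong]: "sets (cond_law S i) = sets (law S)"
  by (simp_all add: cond_law_def)

lemma measurable_samples:
  assumes "l \<in> sensors S"
  shows "samples S l (Suc t) \<in> measurable (law S) (base S)"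
  using distributed_measurable[OF distributed_samples[OF _ assms, of 0]]
  by (simp cong: measurable_cong_sets)

lemma measurable_dens:
  assumes "i \<in> {0, 1}" "l \<in> sensors S"
  shows "dens S i l \<in> borel_measurable (base S)"
  using distributed_real_measurable[OF _ distributed_samples[OF assms]] dens_nonneg[OF assms] by blast

lemma hyp_event:
  assumes "i \<in> {0, 1}"
  shows "{\<omega> \<in> space (law S). hyp S \<omega> = i} \<in> sets (law S)"
proof -
  have "hyp S \<in> measurable (law S) (count_space {0, 1})"
    using model by (simp add: sensing_model_def)
  then have "hyp S -` {i} \<inter> space (law S) \<in> sets (law S)"
    by (rule measurable_sets) (use assms in auto)
  moreover have "hyp S -` {i} \<inter> space (law S) = {\<omega> \<in> space (law S). hyp S \<omega> = i}"
    by blast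
  ultimately show ?thesis by simp
qed

lemma emeasure_hyp:
  assumes "i \<in> {0, 1}"
  shows "emeasure (law S) {\<omega> \<in> space (law S). hyp S \<omega> = i} = ennreal (prior S i)"
proof -
  interpret prob_space "law S" by (rule prob_space_law)
  show ?thesis
    using model assms unfolding sensing_model_def emeasure_eq_measure by auto
qed

lemma prob_space_cond_law:
  assumes "i \<in> {0, 1}"
  shows "prob_space (cond_law S i)"
  unfolding cond_law_def
  using emeasure_hyp[OF assms] prior_pos[OF assms] by (intro prob_space_uniform_measure) auto

lemma AE_cond_law:
  assumes "i \<in> {0, 1}" "AE \<omega> in law S. P \<omega>"
  shows "AE \<omega> in cond_law S i. P \<omega>"
  unfolding cond_law_def
  by (rule AE_uniform_measureI[OF hyp_event[OF assms(1)]]) (use assms(2) in auto)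

text \<open>Total expectation: the two hypothesis events partition the space, and conditioning
  divides by a prior that is positive and so can be multiplied back.\<close>

lemma nn_integral_law:
  assumes [measurable]: "f \<in> borel_measurable (law S)"
  shows "(\<integral>\<^sup>+\<omega>. f \<omega> \<partial>law S)
    = ennreal (prior S 0) * (\<integral>\<^sup>+\<omega>. f \<omega> \<partial>cond_law S 0) + ennreal (prior S 1) * (\<integral>\<^sup>+\<omega>. f \<omega> \<partial>cond_law S 1)"
proof -
  define E where "E i = {\<omega> \<in> space (law S). hyp S \<omega> = i}" for i
  have [measurable]: "E i \<in> sets (law S)" if "i \<in> {0, 1}" for i
    using hyp_event that by (simp add: E_def)
  have E: "ennreal (prior S i) * (\<integral>\<^sup>+\<omega>. f \<omega> \<partial>cond_law S i) = (\<integral>\<^sup>+\<omega>. f \<omega> * indicator (E i) \<omega> \<partial>law S)"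
    if "i \<in> {0, 1}" for i
  proof -
    have "(\<integral>\<^sup>+\<omega>. f \<omega> \<partial>cond_law S i) = (\<integral>\<^sup>+\<omega>. f \<omega> * indicator (E i) \<omega> \<partial>law S) / ennreal (prior S i)"
      using hyp_event[OF that] emeasure_hyp[OF that]
      by (simp add: cond_law_def nn_integral_uniform_measure E_def)
    then show ?thesis
      using prior_pos[OF that]
      by (simp add: ennreal_times_divide ennreal_mult_divide_eq mult.commute[of "ennreal (prior S i)"])
  qed
  have "hyp S \<in> space (law S) \<rightarrow> {0, 1}"
    using model by (auto simp: sensing_model_def measurable_def)
  then have "(\<integral>\<^sup>+\<omega>. f \<omega> \<partial>law S) = (\<integral>\<^sup>+\<omega>. f \<omega> * indicator (E 0) \<omega> + f \<omega> * indicator (E 1) \<omega> \<partial>law S)"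
    by (intro nn_integral_cong) (force simp: E_def indicator_def)
  also have "\<dots> = (\<integral>\<^sup>+\<omega>. f \<omega> * indicator (E 0) \<omega> \<partial>law S) + (\<integral>\<^sup>+\<omega>. f \<omega> * indicator (E 1) \<omega> \<partial>law S)"
    by (intro nn_integral_add) measurable
  finally show ?thesis by (simp add: E)
qed

section \<open>Measurability of histories and their factorisation through the sample array\<close>

lemma measurable_sel [measurable]:
  "sel p (Suc t) \<in> measurable (hist_space t) (count_space (sensors S))"
  using proc by (auto simp: is_procedure_def atLeastLessThanSuc_atLeastAtMost dest!: spec[of _ "Suc t"])

lemma measurable_halt [measurable]: "halt p t \<in> measurable (hist_space t) (count_space UNIV)"
  using proc by (simp add: is_procedure_def)

lemma measurable_dec [measurable]: "dec p t \<in> measurable (hist_space t) (count_space {0, 1})"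
  using proc by (simp add: is_procedure_def)

text \<open>The next entry is a coordinate with a random index, but the index ranges over finitely
  many sensors, so measurability survives. The horizon \<open>N\<close> stays fixed in the induction
  so that all shorter histories live on one product space.\<close>

lemma measurable_history_of:
  "n \<le> N \<Longrightarrow> history_of p n \<in> measurable (PiM (sensors S \<times> {1..N}) (\<lambda>_. base S)) (hist_space n)"
proof (induction n)
  case 0
  show ?case by (simp add: measurable_def space_PiM PiE_def sets_PiM_empty)
next
  case (Suc n)
  then have IH [measurable]: "history_of p n \<in> measurable (PiM (sensors S \<times> {1..N}) (\<lambda>_. base S)) (hist_space n)"
    by simp
  have "(\<lambda>z. z (sel p (Suc n) (history_of p n z), Suc n))
      \<in> measurable (PiM (sensors S \<times> {1..N}) (\<lambda>_. base S)) (base S)"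
    by (rule measurable_compose_countable'[where I = "sensors S" and f = "\<lambda>l z. z (l, Suc n)"])
       (use Suc.prems measurable_compose[OF IH measurable_sel] in
         \<open>auto intro!: measurable_component_singleton intro: countable_finite\<close>)
  then have "(\<lambda>z. (history_of p n z)(Suc n := z (sel p (Suc n) (history_of p n z), Suc n)))
      \<in> measurable (PiM (sensors S \<times> {1..N}) (\<lambda>_. base S)) (hist_space (Suc n))"
    by (rule measurable_fun_upd[OF insert_Suc_interval IH])
  then show ?case unfolding history_of.simps .
qed

lemma measurable_sample_family:
  "(\<lambda>\<omega>. restrict (\<lambda>(l, t). samples S l t \<omega>) (sensors S \<times> {1..N}))
    \<in> measurable (law S) (PiM (sensors S \<times> {1..N}) (\<lambda>_. base S))"
proof (rule measurable_restrict)
  fix k assume "k \<in> sensors S \<times> {1..N}"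
  then obtain l t where "k = (l, Suc t)" "l \<in> sensors S"
    by (cases k, cases "snd k") auto
  then show "(\<lambda>\<omega>. case k of (l, t) \<Rightarrow> samples S l t \<omega>) \<in> measurable (law S) (base S)"
    using measurable_samples by simp
qed

text \<open>Cutting the array down to \<open>sensors S \<times> {1..N}\<close> loses nothing: every
  selection made by a procedure is a sensor, and a history of length \<open>n\<close> reads only
  entries up to time \<open>n\<close>.\<close>

lemma history_eq_history_of:
  assumes "\<omega> \<in> space (law S)"
  shows "n \<le> N \<Longrightarrow> history S p n \<omega>
    = history_of p n (restrict (\<lambda>(l, t). samples S l t \<omega>) (sensors S \<times> {1..N}))"
proof (induction n)
  case (Suc n)
  define z where "z = restrict (\<lambda>(l, t). samples S l t \<omega>) (sensors S \<times> {1..N})"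
  have "z \<in> space (PiM (sensors S \<times> {1..N}) (\<lambda>_. base S))"
    unfolding z_def
    by (rule measurable_space[OF measurable_sample_family assms])
  then have "history_of p n z \<in> space (hist_space n)"
    using Suc.prems by (intro measurable_space[OF measurable_history_of]) auto
  then have sel: "sel p (Suc n) (history_of p n z) \<in> sensors S"
    using measurable_space[OF measurable_sel] by auto
  have "z (l, Suc n) = samples S l (Suc n) \<omega>" if "l \<in> sensors S" for l
    using that Suc.prems by (simp add: z_def)
  moreover have "history S p n \<omega> = history_of p n z"
    unfolding z_def using Suc.prems by (intro Suc.IH) simp
  ultimately show ?case
    using sel unfolding z_def[symmetric] history.simps history_of.simps by simp
qed simp

lemma measurable_history [measurable]: "history S p n \<in> measurable (law S) (hist_space n)"
proof -
  have "(\<lambda>\<omega>. history_of p n (restrict (\<lambda>(l, t). samples S l t \<omega>) (sensors S \<times> {1..n})))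
      \<in> measurable (law S) (hist_space n)"
    by (rule measurable_compose[OF measurable_sample_family measurable_history_of]) simp
  then show ?thesis
    by (rule measurable_cong[THEN iffD2, rotated]) (rule history_eq_history_of[OF _ order_refl])
qed

lemma history_in_space: "\<omega> \<in> space (law S) \<Longrightarrow> history S p n \<omega> \<in> space (hist_space n)"
  by (rule measurable_space[OF measurable_history])

lemma sel_history: "\<omega> \<in> space (law S) \<Longrightarrow> sel p (Suc n) (history S p n \<omega>) \<in> sensors S"
  using measurable_space[OF measurable_sel history_in_space] by auto

section \<open>Independence of the past from the next sample of a fixed sensor\<close>

lemma indep_sample_family:
  assumes i: "i \<in> {0, 1}" and l: "l \<in> sensors S"
  shows "prob_space.indep_var (cond_law S i)
    (PiM (sensors S \<times> {1..n}) (\<lambda>_. base S))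
    (\<lambda>\<omega>. restrict (\<lambda>(l, t). samples S l t \<omega>) (sensors S \<times> {1..n}))
    (PiM {(l, Suc n)} (\<lambda>_. base S))
    (\<lambda>\<omega>. restrict (\<lambda>(l, t). samples S l t \<omega>) {(l, Suc n)})"
proof -
  interpret P: prob_space "cond_law S i" by (rule prob_space_cond_law[OF i])
  let ?X = "\<lambda>(l, t). samples S l t"
  have fam: "(\<lambda>\<omega>. restrict (\<lambda>k. ?X k \<omega>) K) = (\<lambda>\<omega>. restrict (\<lambda>(l, t). samples S l t \<omega>) K)" for K
    by (auto simp: fun_eq_iff restrict_def)
  \<comment> \<open>The first block ends at time \<open>n\<close> and the second is one index at
    time \<open>Suc n\<close>, so they are disjoint. The sensor \<open>l\<close> is fixed here; the
    selected one depends on the past.\<close>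
  show ?thesis
    unfolding fam[symmetric]
    by (rule P.indep_var_restrict[OF indep_samples[OF i]]) (use l in auto)
qed

lemma distr_samples:
  assumes "i \<in> {0, 1}" "l \<in> sensors S"
  shows "distr (cond_law S i) (base S) (samples S l (Suc n)) = sample_law S i l"
  using distributed_distr_eq_density[OF distributed_samples[OF assms]] by (simp add: sample_law_def)

lemma prob_space_sample_law:
  assumes "i \<in> {0, 1}" "l \<in> sensors S"
  shows "prob_space (sample_law S i l)"
proof -
  interpret P: prob_space "cond_law S i" by (rule prob_space_cond_law[OF assms(1)])
  show ?thesis
    using P.prob_space_distr[of "samples S l (Suc 0)" "base S"] measurable_samples[OF assms(2), of 0]
    unfolding distr_samples[OF assms, of 0] by (simp cong: measurable_cong_sets)
qed

lemma sets_sample_law [simp, measurable_cong]: "sets (sample_law S i l) = sets (base S)"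
  and space_sample_law [simp]: "space (sample_law S i l) = space (base S)"
  by (simp_all add: sample_law_def)

text \<open>The history is a function of the block of the array up to time \<open>n\<close>, and the
  sample is a coordinate of an independent block. Pushing the product law of the two blocks forward
  keeps it a product.\<close>

lemma distr_history_sample:
  assumes i: "i \<in> {0, 1}" and l: "l \<in> sensors S"
  shows "distr (cond_law S i) (hist_space n) (history S p n) \<Otimes>\<^sub>M sample_law S i l
    = distr (cond_law S i) (hist_space n \<Otimes>\<^sub>M base S) (\<lambda>\<omega>. (history S p n \<omega>, samples S l (Suc n) \<omega>))"
proof -
  interpret P: prob_space "cond_law S i" by (rule prob_space_cond_law[OF i])
  interpret Q: prob_space "sample_law S i l" by (rule prob_space_sample_law[OF i l])
  let ?MA = "PiM (sensors S \<times> {1..n}) (\<lambda>_. base S)" and ?MB = "PiM {(l, Suc n)} (\<lambda>_. base S)"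
  let ?Z = "\<lambda>K \<omega>. restrict (\<lambda>(l, t). samples S l t \<omega>) K"
  let ?ZA = "?Z (sensors S \<times> {1..n})" and ?ZB = "?Z {(l, Suc n)}"
  let ?pr = "\<lambda>z. z (l, Suc n)"
  have [measurable]: "?ZA \<in> measurable (cond_law S i) ?MA" "?ZB \<in> measurable (cond_law S i) ?MB"
    and joint: "distr (cond_law S i) ?MA ?ZA \<Otimes>\<^sub>M distr (cond_law S i) ?MB ?ZB
      = distr (cond_law S i) (?MA \<Otimes>\<^sub>M ?MB) (\<lambda>\<omega>. (?ZA \<omega>, ?ZB \<omega>))"
    using indep_sample_family[OF i l, of n] unfolding P.indep_var_distribution_eq by auto
  have [measurable]: "history_of p n \<in> measurable ?MA (hist_space n)"
    by (rule measurable_history_of) simp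
  have [measurable]: "?pr \<in> measurable ?MB (base S)"
    by (rule measurable_component_singleton) simp
  have H: "history_of p n (?ZA \<omega>) = history S p n \<omega>" if "\<omega> \<in> space (cond_law S i)" for \<omega>
    using history_eq_history_of[of \<omega> n n] that by simp
  have hist: "distr (distr (cond_law S i) ?MA ?ZA) (hist_space n) (history_of p n)
      = distr (cond_law S i) (hist_space n) (history S p n)"
    by (subst distr_distr) (auto intro!: distr_cong simp: H)
  have smp: "distr (distr (cond_law S i) ?MB ?ZB) (base S) ?pr = sample_law S i l"
    by (subst distr_distr) (auto simp: distr_samples[OF i l, symmetric, of n] comp_def)
  have "distr (cond_law S i) (hist_space n) (history S p n) \<Otimes>\<^sub>M sample_law S i l
      = distr (distr (cond_law S i) ?MA ?ZA) (hist_space n) (history_of p n)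
        \<Otimes>\<^sub>M distr (distr (cond_law S i) ?MB ?ZB) (base S) ?pr"
    by (simp only: hist smp)
  also have "\<dots> = distr (distr (cond_law S i) ?MA ?ZA \<Otimes>\<^sub>M distr (cond_law S i) ?MB ?ZB)
      (hist_space n \<Otimes>\<^sub>M base S) (\<lambda>(x, y). (history_of p n x, ?pr y))"
    by (rule pair_measure_distr) (simp_all add: smp Q.sigma_finite_measure_axioms)
  also have "\<dots> = distr (cond_law S i) (hist_space n \<Otimes>\<^sub>M base S)
      ((\<lambda>(x, y). (history_of p n x, ?pr y)) \<circ> (\<lambda>\<omega>. (?ZA \<omega>, ?ZB \<omega>)))"
    unfolding joint by (rule distr_distr) measurable
  also have "\<dots> = distr (cond_law S i) (hist_space n \<Otimes>\<^sub>M base S)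
      (\<lambda>\<omega>. (history S p n \<omega>, samples S l (Suc n) \<omega>))"
    by (rule distr_cong) (auto simp: H)
  finally show ?thesis .
qed

text \<open>Serves Wald's identity with \<open>a\<close> the indicator that sensor \<open>l\<close>
  is used next: the past decides this event, so it is independent of the sample it triggers. The
  function \<open>\<phi>\<close> may change sign, hence the integrability assumptions.\<close>

lemma integral_history_sample:
  fixes a :: "(nat \<Rightarrow> 'a) \<Rightarrow> real" and \<phi> :: "'a \<Rightarrow> real"
  assumes i: "i \<in> {0, 1}" and l: "l \<in> sensors S"
    and a [measurable]: "a \<in> borel_measurable (hist_space n)"
    and a_int: "integrable (cond_law S i) (\<lambda>\<omega>. a (history S p n \<omega>))"
    and \<phi>: "integrable (sample_law S i l) \<phi>"
  shows "integrable (cond_law S i) (\<lambda>\<omega>. a (history S p n \<omega>) * \<phi> (samples S l (Suc n) \<omega>))"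
    and "(\<integral>\<omega>. a (history S p n \<omega>) * \<phi> (samples S l (Suc n) \<omega>) \<partial>cond_law S i)
      = (\<integral>\<omega>. a (history S p n \<omega>) \<partial>cond_law S i) * (\<integral>x. \<phi> x \<partial>sample_law S i l)"
proof -
  interpret P: prob_space "cond_law S i" by (rule prob_space_cond_law[OF i])
  let ?Z = "\<lambda>K \<omega>. restrict (\<lambda>(l, t). samples S l t \<omega>) K"
  let ?ZA = "?Z (sensors S \<times> {1..n})" and ?ZB = "?Z {(l, Suc n)}"
  have [measurable]: "\<phi> \<in> borel_measurable (base S)"
    using borel_measurable_integrable[OF \<phi>] by (simp cong: measurable_cong_sets)
  have smp [measurable]: "samples S l (Suc n) \<in> measurable (cond_law S i) (base S)"
    using measurable_samples[OF l] by (simp cong: measurable_cong_sets)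
  have [measurable]: "history_of p n \<in> measurable (PiM (sensors S \<times> {1..n}) (\<lambda>_. base S)) (hist_space n)"
    by (rule measurable_history_of) simp
  have H: "history_of p n (?ZA \<omega>) = history S p n \<omega>" if "\<omega> \<in> space (cond_law S i)" for \<omega>
    using history_eq_history_of[of \<omega> n n] that by simp
  have "P.indep_var borel ((\<lambda>z. a (history_of p n z)) \<circ> ?ZA) borel ((\<lambda>z. \<phi> (z (l, Suc n))) \<circ> ?ZB)"
    by (rule P.indep_var_compose[OF indep_sample_family[OF i l]]) auto
  then have ind: "P.indep_var borel (\<lambda>\<omega>. a (history_of p n (?ZA \<omega>))) borel (\<lambda>\<omega>. \<phi> (samples S l (Suc n) \<omega>))"
    by (simp add: comp_def)
  have \<phi>': "integrable (cond_law S i) (\<lambda>\<omega>. \<phi> (samples S l (Suc n) \<omega>))"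
    using \<phi> unfolding distr_samples[OF i l, of n, symmetric] by (subst (asm) integrable_distr_eq) auto
  have a': "integrable (cond_law S i) (\<lambda>\<omega>. a (history_of p n (?ZA \<omega>)))"
    using a_int by (rule Bochner_Integration.integrable_cong[THEN iffD1, rotated -1]) (simp_all add: H)
  have "integrable (cond_law S i) (\<lambda>\<omega>. a (history_of p n (?ZA \<omega>)) * \<phi> (samples S l (Suc n) \<omega>))"
    by (rule P.indep_var_integrable[OF ind a' \<phi>'])
  then show "integrable (cond_law S i) (\<lambda>\<omega>. a (history S p n \<omega>) * \<phi> (samples S l (Suc n) \<omega>))"
    by (rule Bochner_Integration.integrable_cong[THEN iffD1, rotated -1]) (simp_all add: H)
  have "(\<integral>\<omega>. a (history S p n \<omega>) * \<phi> (samples S l (Suc n) \<omega>) \<partial>cond_law S i)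
      = (\<integral>\<omega>. a (history_of p n (?ZA \<omega>)) * \<phi> (samples S l (Suc n) \<omega>) \<partial>cond_law S i)"
    by (rule Bochner_Integration.integral_cong) (simp_all add: H)
  also have "\<dots> = (\<integral>\<omega>. a (history_of p n (?ZA \<omega>)) \<partial>cond_law S i) * (\<integral>\<omega>. \<phi> (samples S l (Suc n) \<omega>) \<partial>cond_law S i)"
    by (rule P.indep_var_lebesgue_integral[OF ind a' \<phi>'])
  also have "(\<integral>\<omega>. a (history_of p n (?ZA \<omega>)) \<partial>cond_law S i) = (\<integral>\<omega>. a (history S p n \<omega>) \<partial>cond_law S i)"
    by (rule Bochner_Integration.integral_cong) (simp_all add: H)
  also have "(\<integral>\<omega>. \<phi> (samples S l (Suc n) \<omega>) \<partial>cond_law S i) = (\<integral>x. \<phi> x \<partial>sample_law S i l)"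
    unfolding distr_samples[OF i l, of n, symmetric] by (subst integral_distr) auto
  finally show "(\<integral>\<omega>. a (history S p n \<omega>) * \<phi> (samples S l (Suc n) \<omega>) \<partial>cond_law S i)
      = (\<integral>\<omega>. a (history S p n \<omega>) \<partial>cond_law S i) * (\<integral>x. \<phi> x \<partial>sample_law S i l)" .
qed

text \<open>Tonelli on the product law. Here the integrand may couple history and sample, as the
  change of measure requires, in exchange for being nonnegative.\<close>

lemma nn_integral_history_sample:
  assumes i: "i \<in> {0, 1}" and l: "l \<in> sensors S"
    and g [measurable]: "g \<in> borel_measurable (hist_space n \<Otimes>\<^sub>M base S)"
  shows "(\<integral>\<^sup>+\<omega>. g (history S p n \<omega>, samples S l (Suc n) \<omega>) \<partial>cond_law S i)
    = (\<integral>\<^sup>+\<omega>. \<integral>\<^sup>+x. g (history S p n \<omega>, x) \<partial>sample_law S i l \<partial>cond_law S i)"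
proof -
  interpret P: prob_space "cond_law S i" by (rule prob_space_cond_law[OF i])
  interpret Q: prob_space "sample_law S i l" by (rule prob_space_sample_law[OF i l])
  have [measurable]: "samples S l (Suc n) \<in> measurable (cond_law S i) (base S)"
    using measurable_samples[OF l] by (simp cong: measurable_cong_sets)
  have [measurable]: "history S p n \<in> measurable (cond_law S i) (hist_space n)"
    using measurable_history by (simp cong: measurable_cong_sets)
  let ?D = "distr (cond_law S i) (hist_space n) (history S p n)"
  have g': "g \<in> borel_measurable (?D \<Otimes>\<^sub>M sample_law S i l)"
    by measurable
  have "(\<integral>\<^sup>+\<omega>. g (history S p n \<omega>, samples S l (Suc n) \<omega>) \<partial>cond_law S i)
     = (\<integral>\<^sup>+y. g y \<partial>distr (cond_law S i) (hist_space n \<Otimes>\<^sub>M base S) (\<lambda>\<omega>. (history S p n \<omega>, samples S l (Suc n) \<omega>)))"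
    by (subst nn_integral_distr) auto
  also have "\<dots> = (\<integral>\<^sup>+y. g y \<partial>(?D \<Otimes>\<^sub>M sample_law S i l))"
    by (simp only: distr_history_sample[OF i l])
  also have "\<dots> = (\<integral>\<^sup>+h. \<integral>\<^sup>+x. g (h, x) \<partial>sample_law S i l \<partial>?D)"
    by (rule Q.nn_integral_fst[OF g', symmetric])
  also have "\<dots> = (\<integral>\<^sup>+\<omega>. \<integral>\<^sup>+x. g (history S p n \<omega>, x) \<partial>sample_law S i l \<partial>cond_law S i)"
    by (rule nn_integral_distr) measurable
  finally show ?thesis .
qed

section \<open>Stopping and sensor usage as events of the history\<close>

definition running :: "nat \<Rightarrow> (nat \<Rightarrow> 'a) \<Rightarrow> bool" where
  "running n h \<longleftrightarrow> (\<forall>s\<le>n. \<not> halt p s (restrict h {1..s}))"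

lemma measurable_restrict_hist [measurable]:
  "m \<le> n \<Longrightarrow> (\<lambda>h. restrict h {1..m}) \<in> measurable (hist_space n) (hist_space m)"
  by (rule measurable_restrict_subset) auto

text \<open>Each halting test is read off an initial block of the history, which is why
  \<open>running\<close> restricts, and only finitely many tests occur. The test at
  \<open>s = 0\<close> is among them, since stopping without any sample is allowed.\<close>

lemma measurable_running [measurable]: "Measurable.pred (hist_space n) (running n)"
proof -
  have "Measurable.pred (hist_space n) (\<lambda>h. halt p s (restrict h {1..s}))" if "s \<le> n" for s
    by (rule measurable_compose[OF measurable_restrict_hist[OF that] measurable_halt])
  then have "Measurable.pred (hist_space n) (\<lambda>h. \<forall>s\<in>{..n}. \<not> halt p s (restrict h {1..s}))"
    by (intro pred_intros_finite pred_intros_logic) auto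
  then show ?thesis by (simp add: running_def[abs_def] Ball_def)
qed

lemma history_outside: "k \<notin> {1..n} \<Longrightarrow> history S p n \<omega> k = undefined"
  by (induction n) auto

lemma restrict_history: "m \<le> n \<Longrightarrow> restrict (history S p n \<omega>) {1..m} = history S p m \<omega>"
proof (induction n)
  case 0
  then show ?case by (auto simp: restrict_def)
next
  case (Suc n)
  show ?case
  proof (cases "m \<le> n")
    case True
    then have "restrict (history S p (Suc n) \<omega>) {1..m} = restrict (history S p n \<omega>) {1..m}"
      by (auto simp: restrict_def fun_eq_iff)
    then show ?thesis using Suc.IH[OF True] by argo
  next
    case False
    then have "m = Suc n" using Suc.prems by simp
    then show ?thesis
      using history_outside[of _ "Suc n" \<omega>] by (auto simp: restrict_def simp del: history.simps)
  qed
qed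

text \<open>An infimum of times exceeds \<open>n\<close> exactly when every halting time is at least
  \<open>Suc n\<close>. This includes the empty set of halting times, where the stopping time is
  infinite.\<close>

lemma less_stop_time_iff: "enat n < stop_time S p \<omega> \<longleftrightarrow> running n (history S p n \<omega>)"
  unfolding stop_time_def Suc_ile_eq[symmetric] le_INF_iff running_def
  by (auto simp: restrict_history not_less_eq_eq)

definition stops_at :: "nat \<Rightarrow> (nat \<Rightarrow> 'a) \<Rightarrow> bool" where
  "stops_at n h \<longleftrightarrow> \<not> running n h \<and> (\<forall>m<n. running m (restrict h {1..m}))"

lemma measurable_stops_at [measurable]: "Measurable.pred (hist_space n) (stops_at n)"
proof -
  have "Measurable.pred (hist_space n) (\<lambda>h. running m (restrict h {1..m}))" if "m < n" for m
    by (rule measurable_compose[OF measurable_restrict_hist measurable_running]) (use that in simp)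
  then have "Measurable.pred (hist_space n) (\<lambda>h. \<not> running n h \<and> (\<forall>m\<in>{..<n}. running m (restrict h {1..m})))"
    by (intro pred_intros_finite pred_intros_logic measurable_running) auto
  then show ?thesis by (simp add: stops_at_def[abs_def] Ball_def)
qed

lemma stop_time_eq_iff: "stop_time S p \<omega> = enat n \<longleftrightarrow> stops_at n (history S p n \<omega>)"
proof -
  have "stop_time S p \<omega> = enat n \<longleftrightarrow> \<not> enat n < stop_time S p \<omega> \<and> (\<forall>m<n. enat m < stop_time S p \<omega>)"
  proof (cases "stop_time S p \<omega>")
    case (enat k)
    then show ?thesis by (auto simp: not_less) (meson linorder_neqE_nat order.strict_iff_not)
  qed auto
  then show ?thesis by (auto simp: less_stop_time_iff stops_at_def restrict_history)
qed

text \<open>Index \<open>n\<close> refers to the sample at time \<open>Suc n\<close>. Whether that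
  sample is taken, and from which sensor, is already known from the first \<open>n\<close> samples:
  the event is predictable.\<close>

definition uses :: "nat \<Rightarrow> nat \<Rightarrow> (nat \<Rightarrow> 'a) \<Rightarrow> bool" where
  "uses l n h \<longleftrightarrow> running n h \<and> sel p (Suc n) h = l"

lemma measurable_uses [measurable]: "Measurable.pred (hist_space n) (uses l n)"
proof -
  have "Measurable.pred (hist_space n) (\<lambda>h. sel p (Suc n) h = l)"
    by (rule measurable_compose[OF measurable_sel, of "\<lambda>k. k = l"]) simp
  then show ?thesis unfolding uses_def[abs_def] by (intro pred_intros_logic measurable_running)
qed

lemma uses_iff:
  "uses l n (history S p n \<omega>) \<longleftrightarrow> enat (Suc n) \<le> stop_time S p \<omega> \<and> selected S p (Suc n) \<omega> = l"
  by (simp add: uses_def less_stop_time_iff[symmetric] Suc_ile_eq selected_def)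

section \<open>Expected usages and Wald's identity for one sensor\<close>

definition cond_usage :: "nat \<Rightarrow> nat \<Rightarrow> ennreal" where
  "cond_usage i l = (\<integral>\<^sup>+\<omega>. (\<Sum>n. of_bool (uses l n (history S p n \<omega>))) \<partial>cond_law S i)"

lemma measurable_history_cond [measurable]:
  "history S p n \<in> measurable (cond_law S i) (hist_space n)"
  using measurable_history by (simp cong: measurable_cong_sets)

lemma measurable_of_bool_uses [measurable]:
  "(\<lambda>h. of_bool (uses l n h) :: ennreal) \<in> borel_measurable (hist_space n)"
  "(\<lambda>h. of_bool (uses l n h) :: real) \<in> borel_measurable (hist_space n)"
  unfolding of_bool_def by measurable

lemma expected_usage_eq:
  "expected_usage S p l = ennreal (prior S 0) * cond_usage 0 l + ennreal (prior S 1) * cond_usage 1 l"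
proof -
  have "expected_usage S p l = (\<integral>\<^sup>+\<omega>. (\<Sum>n. of_bool (uses l n (history S p n \<omega>))) \<partial>law S)"
    unfolding expected_usage_def uses_iff of_bool_def ..
  also have "\<dots> = ennreal (prior S 0) * cond_usage 0 l + ennreal (prior S 1) * cond_usage 1 l"
    unfolding cond_usage_def by (rule nn_integral_law) measurable
  finally show ?thesis .
qed

text \<open>At every time before stopping exactly one sensor is in use, so the usage indicators add
  up to the indicator of still running.\<close>

lemma expected_time_eq: "expected_time S p = (\<Sum>l\<in>sensors S. expected_usage S p l)"
proof -
  have "expected_time S p = (\<integral>\<^sup>+\<omega>. (\<Sum>l\<in>sensors S. \<Sum>n. of_bool (uses l n (history S p n \<omega>))) \<partial>law S)"
    unfolding expected_time_def
  proof (rule nn_integral_cong)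
    fix \<omega> assume \<omega>: "\<omega> \<in> space (law S)"
    have "of_bool (enat n < stop_time S p \<omega>) = (\<Sum>l\<in>sensors S. of_bool (uses l n (history S p n \<omega>)) :: ennreal)" for n
      using sel_history[OF \<omega>, of n]
      by (simp add: uses_def less_stop_time_iff of_bool_conj sum_distrib_left[symmetric] of_bool_def sum.delta)
    then have "(\<Sum>n. of_bool (enat n < stop_time S p \<omega>))
        = (\<Sum>n. \<Sum>l\<in>sensors S. of_bool (uses l n (history S p n \<omega>)) :: ennreal)"
      by presburger
    also have "\<dots> = (\<Sum>l\<in>sensors S. \<Sum>n. of_bool (uses l n (history S p n \<omega>)))"
      by (rule suminf_sum) simp
    finally show "ennreal_of_enat (stop_time S p \<omega>)
        = (\<Sum>l\<in>sensors S. \<Sum>n. of_bool (uses l n (history S p n \<omega>)))"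
      unfolding suminf_of_bool_less_enat .
  qed
  also have "\<dots> = (\<Sum>l\<in>sensors S. \<integral>\<^sup>+\<omega>. (\<Sum>n. of_bool (uses l n (history S p n \<omega>))) \<partial>law S)"
    by (rule nn_integral_sum) measurable
  also have "\<dots> = (\<Sum>l\<in>sensors S. expected_usage S p l)"
    unfolding expected_usage_def uses_iff of_bool_def ..
  finally show ?thesis .
qed

text \<open>Each term factors into the probability of using \<open>l\<close> at time
  \<open>Suc n\<close> and the mean of \<open>\<phi>\<close>. Finite expected usage makes these
  probabilities summable, hence the series absolutely convergent in mean, and expectation and sum
  may be exchanged.\<close>

lemma wald_identity_sensor:
  fixes \<phi> :: "'a \<Rightarrow> real"
  assumes i: "i \<in> {0, 1}" and l: "l \<in> sensors S"
    and fin: "cond_usage i l < \<infinity>" "AE \<omega> in cond_law S i. stop_time S p \<omega> < \<infinity>"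
    and \<phi>: "integrable (sample_law S i l) \<phi>"
  defines "\<xi> \<equiv> \<lambda>n \<omega>. of_bool (uses l n (history S p n \<omega>)) * \<phi> (samples S l (Suc n) \<omega>)"
  shows "integrable (cond_law S i) (\<lambda>\<omega>. \<Sum>n. \<xi> n \<omega>)"
    and "(\<integral>\<omega>. (\<Sum>n. \<xi> n \<omega>) \<partial>cond_law S i) = enn2real (cond_usage i l) * (\<integral>x. \<phi> x \<partial>sample_law S i l)"
proof -
  interpret P: prob_space "cond_law S i" by (rule prob_space_cond_law[OF i])
  define u :: "nat \<Rightarrow> real" where "u n = (\<integral>\<omega>. of_bool (uses l n (history S p n \<omega>)) \<partial>cond_law S i)" for n
  have meas: "(\<lambda>\<omega>. of_bool (uses l n (history S p n \<omega>)) :: real) \<in> borel_measurable (cond_law S i)" for n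
    by (rule measurable_compose[OF measurable_history_cond measurable_of_bool_uses(2)])
  have ind: "integrable (cond_law S i) (\<lambda>\<omega>. of_bool (uses l n (history S p n \<omega>)) :: real)" for n
    by (rule P.integrable_const_bound[where B = 1, OF _ meas]) auto
  have u0: "0 \<le> u n" for n
    by (simp add: u_def)
  have "cond_usage i l = (\<Sum>n. \<integral>\<^sup>+\<omega>. of_bool (uses l n (history S p n \<omega>)) \<partial>cond_law S i)"
    unfolding cond_usage_def by (rule nn_integral_suminf) measurable
  also have "\<dots> = (\<Sum>n. ennreal (u n))"
  proof (rule suminf_cong)
    fix n
    have "(\<integral>\<^sup>+\<omega>. of_bool (uses l n (history S p n \<omega>)) \<partial>cond_law S i)
        = (\<integral>\<^sup>+\<omega>. ennreal (of_bool (uses l n (history S p n \<omega>))) \<partial>cond_law S i)"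
      by (intro nn_integral_cong) (simp add: of_bool_def)
    then show "(\<integral>\<^sup>+\<omega>. of_bool (uses l n (history S p n \<omega>)) \<partial>cond_law S i) = ennreal (u n)"
      unfolding u_def by (simp add: nn_integral_eq_integral[OF ind])
  qed
  finally have cu: "cond_usage i l = (\<Sum>n. ennreal (u n))" .
  have sum_u: "summable u"
    using fin(1) u0 unfolding cu by (intro summable_suminf_not_top) auto
  then have cu': "enn2real (cond_usage i l) = (\<Sum>n. u n)"
    unfolding cu using u0 by (simp add: suminf_ennreal2 suminf_nonneg)
  note hs = integral_history_sample[OF i l measurable_of_bool_uses(2) ind]
  have int: "integrable (cond_law S i) (\<xi> n)"
    and val: "(\<integral>\<omega>. \<xi> n \<omega> \<partial>cond_law S i) = u n * (\<integral>x. \<phi> x \<partial>sample_law S i l)" for n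
    unfolding \<xi>_def u_def by (rule hs[OF \<phi>])+
  \<comment> \<open>The same factorisation applied to the absolute value of \<open>\<phi>\<close>
    gives the summable bound for the exchange.\<close>
  have "norm (\<xi> n \<omega>) = of_bool (uses l n (history S p n \<omega>)) * norm (\<phi> (samples S l (Suc n) \<omega>))" for n \<omega>
    by (simp add: \<xi>_def abs_mult)
  then have "(\<integral>\<omega>. norm (\<xi> n \<omega>) \<partial>cond_law S i) = u n * (\<integral>x. norm (\<phi> x) \<partial>sample_law S i l)" for n
    using hs(2)[OF integrable_norm[OF \<phi>], of n] by (simp only: u_def)
  then have norm_sum: "summable (\<lambda>n. \<integral>\<omega>. norm (\<xi> n \<omega>) \<partial>cond_law S i)"
    using summable_mult2[OF sum_u] by simp
  have AE_sum: "AE \<omega> in cond_law S i. summable (\<lambda>n. norm (\<xi> n \<omega>))"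
    using fin(2)
  proof eventually_elim
    case (elim \<omega>)
    then obtain k where k: "stop_time S p \<omega> = enat k" by auto
    show ?case
      \<comment> \<open>Pointwise only the first \<open>k\<close> terms can be nonzero, because
        nothing is used after stopping.\<close>
      by (rule summable_finite[of "{..<k}"]) (auto simp: \<xi>_def uses_iff k)
  qed
  show "integrable (cond_law S i) (\<lambda>\<omega>. \<Sum>n. \<xi> n \<omega>)"
    by (rule integrable_suminf[OF int AE_sum norm_sum])
  have "(\<integral>\<omega>. (\<Sum>n. \<xi> n \<omega>) \<partial>cond_law S i) = (\<Sum>n. u n * (\<integral>x. \<phi> x \<partial>sample_law S i l))"
    unfolding val[symmetric] by (rule integral_suminf[OF int AE_sum norm_sum])
  also have "\<dots> = (\<Sum>n. u n) * (\<integral>x. \<phi> x \<partial>sample_law S i l)"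
    by (rule suminf_mult2[OF sum_u, symmetric])
  finally show "(\<integral>\<omega>. (\<Sum>n. \<xi> n \<omega>) \<partial>cond_law S i)
      = enn2real (cond_usage i l) * (\<integral>x. \<phi> x \<partial>sample_law S i l)"
    by (simp only: cu')
qed

section \<open>Integrating out the sample of the selected sensor\<close>

lemma nn_integral_selected_sample:
  assumes i: "i \<in> {0, 1}"
    and g [measurable]: "\<And>l. l \<in> sensors S \<Longrightarrow> g l \<in> borel_measurable (hist_space n \<Otimes>\<^sub>M base S)"
  defines "s \<equiv> sel p (Suc n)"
  shows "(\<integral>\<^sup>+\<omega>. g (s (history S p n \<omega>)) (history S p n \<omega>, samples S (s (history S p n \<omega>)) (Suc n) \<omega>) \<partial>cond_law S i)
    = (\<integral>\<^sup>+\<omega>. \<integral>\<^sup>+x. g (s (history S p n \<omega>)) (history S p n \<omega>, x) \<partial>sample_law S i (s (history S p n \<omega>)) \<partial>cond_law S i)"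
proof -
  let ?H = "history S p n"
  have s [measurable]: "Measurable.pred (hist_space n) (\<lambda>h. s h = l)" for l
    unfolding s_def by (rule measurable_compose[OF measurable_sel, of "\<lambda>k. k = l"]) simp
  \<comment> \<open>The selected sensor is random, whereas the product law is known for fixed
    sensors only. Expanding over its finitely many values reduces to fixed ones; the same expansion
    read backwards recombines the result.\<close>
  have split: "f (s (?H \<omega>)) = (\<Sum>l\<in>sensors S. of_bool (s (?H \<omega>) = l) * f l)"
    if "\<omega> \<in> space (law S)" for f :: "nat \<Rightarrow> ennreal" and \<omega>
    using sel_history[OF that, of n] by (simp add: s_def of_bool_def if_distrib if_distribR sum.delta cong: if_cong)
  have g' [measurable]: "(\<lambda>(h, x). of_bool (s h = l) * g l (h, x)) \<in> borel_measurable (hist_space n \<Otimes>\<^sub>M base S)"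
    if "l \<in> sensors S" for l
    unfolding of_bool_def using g[OF that] by measurable
  have smp [measurable]: "samples S l (Suc n) \<in> measurable (cond_law S i) (base S)" if "l \<in> sensors S" for l
    using measurable_samples[OF that] by (simp cong: measurable_cong_sets)
  have inner [measurable]: "(\<lambda>h. \<integral>\<^sup>+x. of_bool (s h = l) * g l (h, x) \<partial>sample_law S i l) \<in> borel_measurable (hist_space n)"
    if "l \<in> sensors S" for l
  proof -
    interpret Q: prob_space "sample_law S i l" by (rule prob_space_sample_law[OF i that])
    have "(\<lambda>(h, x). of_bool (s h = l) * g l (h, x)) \<in> borel_measurable (hist_space n \<Otimes>\<^sub>M sample_law S i l)"
      using g'[OF that] by (simp cong: measurable_cong_sets sets_pair_measure_cong)
    then show ?thesis by (rule Q.borel_measurable_nn_integral)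
  qed
  have "(\<integral>\<^sup>+\<omega>. g (s (?H \<omega>)) (?H \<omega>, samples S (s (?H \<omega>)) (Suc n) \<omega>) \<partial>cond_law S i)
      = (\<integral>\<^sup>+\<omega>. (\<Sum>l\<in>sensors S. of_bool (s (?H \<omega>) = l) * g l (?H \<omega>, samples S l (Suc n) \<omega>)) \<partial>cond_law S i)"
    by (intro nn_integral_cong) (rule split[of _ "\<lambda>l. g l (?H _, samples S l (Suc n) _)"], simp)
  also have "\<dots> = (\<Sum>l\<in>sensors S. \<integral>\<^sup>+\<omega>. of_bool (s (?H \<omega>) = l) * g l (?H \<omega>, samples S l (Suc n) \<omega>) \<partial>cond_law S i)"
  proof (rule nn_integral_sum)
    fix l assume l: "l \<in> sensors S"
    have "(\<lambda>\<omega>. (?H \<omega>, samples S l (Suc n) \<omega>)) \<in> measurable (cond_law S i) (hist_space n \<Otimes>\<^sub>M base S)"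
      by (rule measurable_Pair[OF measurable_history_cond smp[OF l]])
    from measurable_compose[OF this g'[OF l]]
    show "(\<lambda>\<omega>. of_bool (s (?H \<omega>) = l) * g l (?H \<omega>, samples S l (Suc n) \<omega>)) \<in> borel_measurable (cond_law S i)"
      by simp
  qed
  also have "\<dots> = (\<Sum>l\<in>sensors S. \<integral>\<^sup>+\<omega>. \<integral>\<^sup>+x. of_bool (s (?H \<omega>) = l) * g l (?H \<omega>, x) \<partial>sample_law S i l \<partial>cond_law S i)"
    using nn_integral_history_sample[OF i _ g'] by simp
  also have "\<dots> = (\<integral>\<^sup>+\<omega>. (\<Sum>l\<in>sensors S. \<integral>\<^sup>+x. of_bool (s (?H \<omega>) = l) * g l (?H \<omega>, x) \<partial>sample_law S i l) \<partial>cond_law S i)"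
    by (rule nn_integral_sum[symmetric]) (rule measurable_compose[OF measurable_history_cond inner])
  also have "\<dots> = (\<integral>\<^sup>+\<omega>. (\<Sum>l\<in>sensors S. of_bool (s (?H \<omega>) = l) * (\<integral>\<^sup>+x. g l (?H \<omega>, x) \<partial>sample_law S i l)) \<partial>cond_law S i)"
    by (intro nn_integral_cong sum.cong refl) (auto simp: of_bool_def)
  also have "\<dots> = (\<integral>\<^sup>+\<omega>. \<integral>\<^sup>+x. g (s (?H \<omega>)) (?H \<omega>, x) \<partial>sample_law S i (s (?H \<omega>)) \<partial>cond_law S i)"
    by (intro nn_integral_cong) (rule split[of _ "\<lambda>l. \<integral>\<^sup>+x. g l (?H _, x) \<partial>sample_law S i l", symmetric], simp)
  finally show ?thesis .
qed

section \<open>The log-likelihood ratio as a function of the history\<close>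

definition log_ratio :: "nat \<Rightarrow> 'a \<Rightarrow> real" where
  "log_ratio l x = ln (dens S 1 l x / dens S 0 l x)"

lemma measurable_log_ratio [measurable]:
  "l \<in> sensors S \<Longrightarrow> log_ratio l \<in> borel_measurable (base S)"
  unfolding log_ratio_def[abs_def]
  by (intro borel_measurable_ln borel_measurable_divide measurable_dens) auto

lemma llr_Suc: "llr S p (Suc n) \<omega> = llr S p n \<omega>
    + log_ratio (sel p (Suc n) (history S p n \<omega>)) (samples S (sel p (Suc n) (history S p n \<omega>)) (Suc n) \<omega>)"
  by (simp add: llr_def log_ratio_def selected_def observed_def)

text \<open>A version of \<open>llr\<close> on the product space of observed samples, needed to
  integrate against the law of the history. The restriction removes the last sample both from the
  recursive call and from the argument of \<open>sel\<close>.\<close>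

primrec llr_of :: "nat \<Rightarrow> (nat \<Rightarrow> 'a) \<Rightarrow> real" where
  "llr_of 0 h = 0"
| "llr_of (Suc n) h = llr_of n (restrict h {1..n})
     + log_ratio (sel p (Suc n) (restrict h {1..n})) (h (Suc n))"

lemma measurable_llr_of [measurable]: "llr_of n \<in> borel_measurable (hist_space n)"
proof (induction n)
  case (Suc n)
  have [measurable]: "(\<lambda>h. restrict h {1..n}) \<in> measurable (hist_space (Suc n)) (hist_space n)"
    by (rule measurable_restrict_hist) simp
  have "(\<lambda>h. log_ratio (sel p (Suc n) (restrict h {1..n})) (h (Suc n))) \<in> borel_measurable (hist_space (Suc n))"
  proof (rule measurable_compose_countable'[where I = "sensors S" and f = "\<lambda>l h. log_ratio l (h (Suc n))"])
    show "(\<lambda>h. log_ratio l (h (Suc n))) \<in> borel_measurable (hist_space (Suc n))" if "l \<in> sensors S" for l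
      by (rule measurable_compose[OF _ measurable_log_ratio[OF that]]) (simp add: measurable_component_singleton)
    show "(\<lambda>h. sel p (Suc n) (restrict h {1..n})) \<in> measurable (hist_space (Suc n)) (count_space (sensors S))"
      by (rule measurable_compose[OF measurable_restrict_hist measurable_sel]) simp
  qed (simp add: countable_finite)
  moreover have "(\<lambda>h. llr_of n (restrict h {1..n})) \<in> borel_measurable (hist_space (Suc n))"
    by (rule measurable_compose[OF measurable_restrict_hist Suc]) simp
  ultimately show ?case unfolding llr_of.simps by (intro borel_measurable_add)
qed simp

lemma llr_eq_llr_of: "llr S p n \<omega> = llr_of n (history S p n \<omega>)"
proof (induction n)
  case 0
  then show ?case by (simp add: llr_def)
next
  case (Suc n)
  have "restrict (history S p (Suc n) \<omega>) {1..n} = history S p n \<omega>"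
    by (rule restrict_history) simp
  then show ?case using Suc unfolding llr_Suc llr_of.simps by simp
qed

end

section \<open>Change of measure between the hypotheses\<close>

locale sensing_procedure_finite_kl = sensing_procedure S p
  for S :: "('w, 'a) sensing" and p :: "'a procedure" +
  assumes finite_kl: "finite_divergences S"
begin

text \<open>The ratio cancels the density under \<open>0\<close> wherever it is positive. Almost
  everywhere else both densities vanish together, so the conventions for division by zero and
  \<open>ln 0\<close> have no effect.\<close>

lemma nn_integral_sample_law_ratio:
  assumes l: "l \<in> sensors S" and k [measurable]: "k \<in> borel_measurable (base S)"
  shows "(\<integral>\<^sup>+x. ennreal (exp (log_ratio l x)) * k x \<partial>sample_law S 0 l) = (\<integral>\<^sup>+x. k x \<partial>sample_law S 1 l)"
proof -
  have [measurable]: "dens S 0 l \<in> borel_measurable (base S)" "dens S 1 l \<in> borel_measurable (base S)"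
    using measurable_dens l by auto
  have [measurable]: "log_ratio l \<in> borel_measurable (base S)"
    by (rule measurable_log_ratio[OF l])
  have "AE x in base S. dens S 0 l x = 0 \<longleftrightarrow> dens S 1 l x = 0"
    using finite_kl l by (auto simp: finite_divergences_def)
  then have *: "AE x in base S. ennreal (dens S 0 l x) * (ennreal (exp (log_ratio l x)) * k x)
      = ennreal (dens S 1 l x) * k x"
  proof (rule AE_mp, intro AE_I2 impI)
    fix x assume x: "x \<in> space (base S)" "dens S 0 l x = 0 \<longleftrightarrow> dens S 1 l x = 0"
    have nonneg: "0 \<le> dens S 0 l x" "0 \<le> dens S 1 l x"
      using dens_nonneg[OF _ l x(1)] by auto
    have "dens S 0 l x * exp (log_ratio l x) = dens S 1 l x"
      using x(2) nonneg by (cases "dens S 0 l x = 0") (auto simp: log_ratio_def)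
    then show "ennreal (dens S 0 l x) * (ennreal (exp (log_ratio l x)) * k x) = ennreal (dens S 1 l x) * k x"
      using nonneg by (metis ennreal_mult mult.assoc exp_ge_zero)
  qed
  show ?thesis
    unfolding sample_law_def using * by (simp add: nn_integral_density nn_integral_cong_AE)
qed

text \<open>Likelihood ratio identity at a fixed time. The last sample is integrated out first: its
  ratio turns the law of that sample under \<open>0\<close> into the one under \<open>1\<close>, and
  what remains is the identity one step earlier for another test function, hence the induction over
  arbitrary \<open>g\<close>.\<close>

lemma change_of_measure:
  "g \<in> borel_measurable (hist_space n) \<Longrightarrow>
    (\<integral>\<^sup>+\<omega>. ennreal (exp (llr S p n \<omega>)) * g (history S p n \<omega>) \<partial>cond_law S 0)
    = (\<integral>\<^sup>+\<omega>. g (history S p n \<omega>) \<partial>cond_law S 1)"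
proof (induction n arbitrary: g)
  case 0
  interpret P0: prob_space "cond_law S 0" by (rule prob_space_cond_law) simp
  interpret P1: prob_space "cond_law S 1" by (rule prob_space_cond_law) simp
  show ?case by (simp add: llr_def P0.emeasure_space_1[simplified] P1.emeasure_space_1[simplified])
next
  case (Suc n)
  let ?H = "history S p n" and ?s = "\<lambda>\<omega>. sel p (Suc n) (history S p n \<omega>)"
  have upd: "(\<lambda>(h, x). h(Suc n := x)) \<in> measurable (hist_space n \<Otimes>\<^sub>M base S) (hist_space (Suc n))"
    using measurable_add_dim[of "Suc n" "{1..n}" "\<lambda>_. base S"] by (simp add: insert_Suc_interval)
  have g [measurable]: "(\<lambda>(h, x). g (h(Suc n := x))) \<in> borel_measurable (hist_space n \<Otimes>\<^sub>M base S)"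
    using measurable_compose[OF upd Suc.prems] unfolding case_prod_unfold .
  have g1: "(\<lambda>x. g (h(Suc n := x))) \<in> borel_measurable (base S)" if "h \<in> space (hist_space n)" for h
    using measurable_compose[OF measurable_Pair1'[OF that] g] by simp
  \<comment> \<open>\<open>K\<close> is the conditional mean of \<open>g\<close> under hypothesis
    \<open>1\<close> given the first \<open>n\<close> samples; it is the test function for the
    induction hypothesis.\<close>
  define K where "K h = (\<integral>\<^sup>+x. g (h(Suc n := x)) \<partial>sample_law S 1 (sel p (Suc n) h))" for h
  have K: "K \<in> borel_measurable (hist_space n)"
    unfolding K_def[abs_def]
  proof (rule measurable_compose_countable'[where I = "sensors S" and g = "sel p (Suc n)"
        and f = "\<lambda>l h. \<integral>\<^sup>+x. g (h(Suc n := x)) \<partial>sample_law S 1 l"])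
    fix l assume l: "l \<in> sensors S"
    interpret Q: prob_space "sample_law S 1 l" by (rule prob_space_sample_law[OF _ l]) simp
    have "(\<lambda>(h, x). g (h(Suc n := x))) \<in> borel_measurable (hist_space n \<Otimes>\<^sub>M sample_law S 1 l)"
      using g by (simp cong: measurable_cong_sets sets_pair_measure_cong)
    then show "(\<lambda>h. \<integral>\<^sup>+x. g (h(Suc n := x)) \<partial>sample_law S 1 l) \<in> borel_measurable (hist_space n)"
      by (rule Q.borel_measurable_nn_integral)
  qed (auto intro: countable_finite measurable_sel)
  \<comment> \<open>The factor depending on the past only is kept separate, so that it can be pulled
    out of the inner integral.\<close>
  define G where "G l = (\<lambda>(h, x). ennreal (exp (llr_of n h)) * (ennreal (exp (log_ratio l x)) * g (h(Suc n := x))))" for l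
  have G: "G l \<in> borel_measurable (hist_space n \<Otimes>\<^sub>M base S)" if "l \<in> sensors S" for l
    unfolding G_def using g measurable_log_ratio[OF that] by measurable
  have "(\<integral>\<^sup>+\<omega>. ennreal (exp (llr S p (Suc n) \<omega>)) * g (history S p (Suc n) \<omega>) \<partial>cond_law S 0)
      = (\<integral>\<^sup>+\<omega>. G (?s \<omega>) (?H \<omega>, samples S (?s \<omega>) (Suc n) \<omega>) \<partial>cond_law S 0)"
    by (intro nn_integral_cong)
       (simp add: G_def llr_Suc exp_add ennreal_mult mult.assoc llr_eq_llr_of[symmetric])
  also have "\<dots> = (\<integral>\<^sup>+\<omega>. \<integral>\<^sup>+x. G (?s \<omega>) (?H \<omega>, x) \<partial>sample_law S 0 (?s \<omega>) \<partial>cond_law S 0)"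
    by (rule nn_integral_selected_sample[OF _ G]) auto
  also have "\<dots> = (\<integral>\<^sup>+\<omega>. ennreal (exp (llr S p n \<omega>)) * K (?H \<omega>) \<partial>cond_law S 0)"
  proof (rule nn_integral_cong)
    fix \<omega> assume "\<omega> \<in> space (cond_law S 0)"
    then have \<omega>: "?H \<omega> \<in> space (hist_space n)" "?s \<omega> \<in> sensors S"
      using history_in_space sel_history by simp_all
    note [measurable] = g1[OF \<omega>(1)] measurable_log_ratio[OF \<omega>(2)]
    have "(\<integral>\<^sup>+x. G (?s \<omega>) (?H \<omega>, x) \<partial>sample_law S 0 (?s \<omega>))
        = ennreal (exp (llr_of n (?H \<omega>)))
          * (\<integral>\<^sup>+x. ennreal (exp (log_ratio (?s \<omega>) x)) * g ((?H \<omega>)(Suc n := x)) \<partial>sample_law S 0 (?s \<omega>))"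
      unfolding G_def prod.case by (rule nn_integral_cmult) measurable
    then show "(\<integral>\<^sup>+x. G (?s \<omega>) (?H \<omega>, x) \<partial>sample_law S 0 (?s \<omega>)) = ennreal (exp (llr S p n \<omega>)) * K (?H \<omega>)"
      by (simp add: nn_integral_sample_law_ratio[OF \<omega>(2) g1[OF \<omega>(1)]] K_def llr_eq_llr_of)
  qed
  also have "\<dots> = (\<integral>\<^sup>+\<omega>. K (?H \<omega>) \<partial>cond_law S 1)"
    by (rule Suc.IH[OF K])
  also have "\<dots> = (\<integral>\<^sup>+\<omega>. g (history S p (Suc n) \<omega>) \<partial>cond_law S 1)"
    unfolding K_def using nn_integral_selected_sample[of 1 "\<lambda>_ (h, x). g (h(Suc n := x))" n] g by simp
  finally show ?case .
qed

section \<open>Decision events and their probabilities\<close>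

lemma decision_cases: "\<omega> \<in> space (law S) \<Longrightarrow> decision S p \<omega> \<in> {0, 1}"
  using measurable_space[OF measurable_dec history_in_space] by (simp add: decision_def Let_def)

definition decides :: "nat \<Rightarrow> nat \<Rightarrow> (nat \<Rightarrow> 'a) \<Rightarrow> bool" where
  "decides d n h \<longleftrightarrow> stops_at n h \<and> dec p n h = d"

lemma decides_iff:
  "decides d n (history S p n \<omega>) \<longleftrightarrow> stop_time S p \<omega> = enat n \<and> decision S p \<omega> = d"
  by (auto simp: decides_def stop_time_eq_iff[symmetric] decision_def)

lemma measurable_decides [measurable]: "Measurable.pred (hist_space n) (decides d n)"
proof -
  have "Measurable.pred (hist_space n) (\<lambda>h. dec p n h = d)"
    by (rule measurable_compose[OF measurable_dec, of "\<lambda>k. k = d"]) simp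
  then show ?thesis unfolding decides_def[abs_def] by (intro pred_intros_logic measurable_stops_at)
qed

lemma measurable_of_bool_decides [measurable]:
  "(\<lambda>h. of_bool (decides d n h) :: ennreal) \<in> borel_measurable (hist_space n)"
  unfolding of_bool_def by measurable

lemma decide_event:
  "{\<omega> \<in> space (law S). stop_time S p \<omega> < \<infinity> \<and> decision S p \<omega> = d}
    = (\<Union>n. {\<omega> \<in> space (law S). decides d n (history S p n \<omega>)})"
  unfolding decides_iff by auto

lemma decide_event_sets [measurable]:
  "{\<omega> \<in> space (law S). stop_time S p \<omega> < \<infinity> \<and> decision S p \<omega> = d} \<in> sets (law S)"
  unfolding decide_event by (intro sets.countable_UN'' predE measurable_compose[OF measurable_history measurable_decides]) auto

text \<open>Decomposes the event by the value of the stopping time, so that identities at fixed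
  times apply term by term. Outcomes that never stop contribute zero to both sides.\<close>

lemma emeasure_decide:
  "emeasure (cond_law S i) {\<omega> \<in> space (law S). stop_time S p \<omega> < \<infinity> \<and> decision S p \<omega> = d}
    = (\<Sum>n. \<integral>\<^sup>+\<omega>. of_bool (decides d n (history S p n \<omega>)) \<partial>cond_law S i)"
proof -
  let ?E = "{\<omega> \<in> space (law S). stop_time S p \<omega> < \<infinity> \<and> decision S p \<omega> = d}"
  have "emeasure (cond_law S i) ?E = (\<integral>\<^sup>+\<omega>. indicator ?E \<omega> \<partial>cond_law S i)"
    by (rule nn_integral_indicator[symmetric]) (simp only: sets_cond_law decide_event_sets)
  also have "\<dots> = (\<integral>\<^sup>+\<omega>. (\<Sum>n. of_bool (decides d n (history S p n \<omega>))) \<partial>cond_law S i)"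
  proof (rule nn_integral_cong)
    fix \<omega> assume \<omega>: "\<omega> \<in> space (cond_law S i)"
    show "indicator ?E \<omega> = (\<Sum>n. of_bool (decides d n (history S p n \<omega>)) :: ennreal)"
    proof (cases "stop_time S p \<omega>")
      case (enat k)
      then have "(\<Sum>n. of_bool (decides d n (history S p n \<omega>)) :: ennreal)
          = (\<Sum>n\<in>{k}. of_bool (decides d n (history S p n \<omega>)))"
        by (intro suminf_finite) (auto simp: decides_iff)
      then show ?thesis using enat \<omega> by (simp add: decides_iff indicator_def)
    qed (simp add: decides_iff indicator_def)
  qed
  also have "\<dots> = (\<Sum>n. \<integral>\<^sup>+\<omega>. of_bool (decides d n (history S p n \<omega>)) \<partial>cond_law S i)"
    by (rule nn_integral_suminf) measurable
  finally show ?thesis .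
qed

text \<open>On the event of deciding \<open>d\<close> the likelihood ratio at stopping is the
  constant \<open>exp c\<close>. It leaves each integral of the series, all of which are taken under
  hypothesis \<open>0\<close> after the change of measure.\<close>

lemma decide_prob_change:
  assumes "AE \<omega> in cond_law S 0. \<forall>n. stop_time S p \<omega> = enat n \<and> decision S p \<omega> = d \<longrightarrow> llr S p n \<omega> = c"
  shows "decide_prob S p 1 d = exp c * decide_prob S p 0 d"
proof -
  let ?E = "{\<omega> \<in> space (law S). stop_time S p \<omega> < \<infinity> \<and> decision S p \<omega> = d}"
  have "emeasure (cond_law S 1) ?E
      = (\<Sum>n. \<integral>\<^sup>+\<omega>. ennreal (exp (llr S p n \<omega>)) * of_bool (decides d n (history S p n \<omega>)) \<partial>cond_law S 0)"
    unfolding emeasure_decide by (simp add: change_of_measure[OF measurable_of_bool_decides])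
  also have "\<dots> = (\<Sum>n. ennreal (exp c) * (\<integral>\<^sup>+\<omega>. of_bool (decides d n (history S p n \<omega>)) \<partial>cond_law S 0))"
  proof (rule suminf_cong)
    fix n
    have "(\<integral>\<^sup>+\<omega>. ennreal (exp (llr S p n \<omega>)) * of_bool (decides d n (history S p n \<omega>)) \<partial>cond_law S 0)
        = (\<integral>\<^sup>+\<omega>. ennreal (exp c) * of_bool (decides d n (history S p n \<omega>)) \<partial>cond_law S 0)"
      by (rule nn_integral_cong_AE) (use assms in eventually_elim, auto simp: decides_iff)
    also have "\<dots> = ennreal (exp c) * (\<integral>\<^sup>+\<omega>. of_bool (decides d n (history S p n \<omega>)) \<partial>cond_law S 0)"
      by (rule nn_integral_cmult) measurable
    finally show "(\<integral>\<^sup>+\<omega>. ennreal (exp (llr S p n \<omega>)) * of_bool (decides d n (history S p n \<omega>)) \<partial>cond_law S 0)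
        = ennreal (exp c) * (\<integral>\<^sup>+\<omega>. of_bool (decides d n (history S p n \<omega>)) \<partial>cond_law S 0)" .
  qed
  also have "\<dots> = ennreal (exp c) * emeasure (cond_law S 0) ?E"
    unfolding emeasure_decide by simp
  finally show ?thesis
    by (simp add: decide_prob_def measure_def enn2real_mult)
qed

text \<open>\<open>decide_prob\<close> counts only outcomes that stop; when almost all do, the two
  disjoint decision events carry the full mass.\<close>

lemma decide_prob_sum:
  assumes i: "i \<in> {0, 1}" and fin: "AE \<omega> in cond_law S i. stop_time S p \<omega> < \<infinity>"
  shows "decide_prob S p i 0 + decide_prob S p i 1 = 1"
proof -
  interpret P: prob_space "cond_law S i" by (rule prob_space_cond_law[OF i])
  let ?E = "\<lambda>d. {\<omega> \<in> space (law S). stop_time S p \<omega> < \<infinity> \<and> decision S p \<omega> = d}"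
  have "AE \<omega> in cond_law S i. \<omega> \<in> ?E 0 \<union> ?E 1"
    using fin AE_space
  proof eventually_elim
    case (elim \<omega>)
    then show ?case using decision_cases[of \<omega>] by simp
  qed
  moreover have "?E 0 \<union> ?E 1 \<in> P.events"
    using decide_event_sets by (simp only: sets_cond_law) (intro sets.Un)
  ultimately have "P.prob (?E 0 \<union> ?E 1) = 1"
    by (simp only: P.prob_eq_1)
  then show ?thesis
    unfolding decide_prob_def
    by (subst (asm) P.finite_measure_Union) (simp_all only: sets_cond_law decide_event_sets, auto)
qed

section \<open>Wald's identity for the stopped log-likelihood ratio\<close>

definition stopped_llr :: "'w \<Rightarrow> real" where
  "stopped_llr \<omega> = llr S p (the_enat (stop_time S p \<omega>)) \<omega>"

text \<open>Regroups the summands by the sensor they come from, so that the identities for single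
  sensors can be added. Finiteness of the stopping time is essential, since \<open>the_enat\<close>
  is unspecified at infinity.\<close>

lemma stopped_llr_eq:
  assumes \<omega>: "\<omega> \<in> space (law S)" and fin: "stop_time S p \<omega> < \<infinity>"
  shows "stopped_llr \<omega> = (\<Sum>l\<in>sensors S. \<Sum>n. of_bool (uses l n (history S p n \<omega>)) * log_ratio l (samples S l (Suc n) \<omega>))"
proof -
  obtain k where k: "stop_time S p \<omega> = enat k" using fin by auto
  have sel: "selected S p (Suc n) \<omega> \<in> sensors S" for n
    using sel_history[OF \<omega>] by (simp add: selected_def)
  have "(\<Sum>n. of_bool (uses l n (history S p n \<omega>)) * log_ratio l (samples S l (Suc n) \<omega>))
      = (\<Sum>n<k. of_bool (selected S p (Suc n) \<omega> = l) * log_ratio l (samples S l (Suc n) \<omega>))" for l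
  proof -
    have "(\<Sum>n. of_bool (uses l n (history S p n \<omega>)) * log_ratio l (samples S l (Suc n) \<omega>))
        = (\<Sum>n<k. of_bool (uses l n (history S p n \<omega>)) * log_ratio l (samples S l (Suc n) \<omega>))"
      by (rule suminf_finite) (auto simp: uses_iff k)
    also have "\<dots> = (\<Sum>n<k. of_bool (selected S p (Suc n) \<omega> = l) * log_ratio l (samples S l (Suc n) \<omega>))"
      by (rule sum.cong) (auto simp: uses_iff k)
    finally show ?thesis .
  qed
  then have "(\<Sum>l\<in>sensors S. \<Sum>n. of_bool (uses l n (history S p n \<omega>)) * log_ratio l (samples S l (Suc n) \<omega>))
      = (\<Sum>l\<in>sensors S. \<Sum>n<k. of_bool (selected S p (Suc n) \<omega> = l) * log_ratio l (samples S l (Suc n) \<omega>))"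
    by simp
  also have "\<dots> = (\<Sum>n<k. \<Sum>l\<in>sensors S. of_bool (selected S p (Suc n) \<omega> = l) * log_ratio l (samples S l (Suc n) \<omega>))"
    by (rule sum.swap)
  also have "\<dots> = (\<Sum>n<k. log_ratio (selected S p (Suc n) \<omega>) (observed S p (Suc n) \<omega>))"
    using sel by (intro sum.cong refl)
      (simp add: of_bool_def if_distrib if_distribR sum.delta observed_def cong: if_cong)
  also have "\<dots> = llr S p k \<omega>"
    unfolding llr_def log_ratio_def
    by (rule sum.reindex_bij_witness[of _ "\<lambda>t. t - 1" Suc]) auto
  finally show ?thesis by (simp add: stopped_llr_def k)
qed

lemma integrable_log_ratio:
  assumes "i \<in> {0, 1}" "l \<in> sensors S"
  shows "integrable (sample_law S i l) (log_ratio l)"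
proof -
  \<comment> \<open>Valid everywhere: where a density vanishes, both quotients are \<open>0\<close>
    and \<open>ln 0 = 0\<close>.\<close>
  have *: "log_ratio l = (\<lambda>x. - ln (dens S 0 l x / dens S 1 l x))"
    by (auto simp: log_ratio_def fun_eq_iff ln_div)
  have "integrable (sample_law S 0 l) (\<lambda>x. ln (dens S 0 l x / dens S 1 l x))"
    "integrable (sample_law S 1 l) (\<lambda>x. ln (dens S 1 l x / dens S 0 l x))"
    using finite_kl assms(2) by (auto simp: finite_divergences_def)
  then have "integrable (sample_law S 0 l) (log_ratio l)" "integrable (sample_law S 1 l) (log_ratio l)"
    by (simp only: * integrable_minus, simp only: log_ratio_def[abs_def])
  then show ?thesis using assms(1) by auto
qed

lemma kl_log_ratio:
  "(\<integral>x. log_ratio l x \<partial>sample_law S 1 l) = kl1 S l"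
  "(\<integral>x. log_ratio l x \<partial>sample_law S 0 l) = - kl0 S l"
proof -
  show "(\<integral>x. log_ratio l x \<partial>sample_law S 1 l) = kl1 S l"
    by (simp add: kl1_def log_ratio_def)
  have "log_ratio l = (\<lambda>x. - ln (dens S 0 l x / dens S 1 l x))"
    by (auto simp: log_ratio_def fun_eq_iff ln_div)
  then show "(\<integral>x. log_ratio l x \<partial>sample_law S 0 l) = - kl0 S l"
    by (simp add: kl0_def)
qed

text \<open>Without overshoot the stopped log-likelihood ratio takes only the values
  \<open>a\<close> and \<open>b\<close>, according to the decision, so its mean is the left-hand
  side. Summing the identities for single sensors computes the same mean.\<close>

lemma wald_identity:
  assumes i: "i \<in> {0, 1}"
    and fin: "\<And>l. l \<in> sensors S \<Longrightarrow> cond_usage i l < \<infinity>" "AE \<omega> in cond_law S i. stop_time S p \<omega> < \<infinity>"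
    and exact: "AE \<omega> in cond_law S i. \<forall>n. stop_time S p \<omega> = enat n \<longrightarrow>
        (decision S p \<omega> = 0 \<longrightarrow> llr S p n \<omega> = a) \<and> (decision S p \<omega> = 1 \<longrightarrow> llr S p n \<omega> = b)"
  shows "decide_prob S p i 0 * a + decide_prob S p i 1 * b
    = (\<Sum>l\<in>sensors S. enn2real (cond_usage i l) * (\<integral>x. log_ratio l x \<partial>sample_law S i l))"
proof -
  interpret P: prob_space "cond_law S i" by (rule prob_space_cond_law[OF i])
  define E where "E d = {\<omega> \<in> space (law S). stop_time S p \<omega> < \<infinity> \<and> decision S p \<omega> = d}" for d
  let ?\<xi> = "\<lambda>l n \<omega>. of_bool (uses l n (history S p n \<omega>)) * log_ratio l (samples S l (Suc n) \<omega>)"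
  have E [measurable]: "E d \<in> P.events" for d
    unfolding E_def by (simp only: sets_cond_law decide_event_sets)
  have [simp]: "E d \<inter> space (law S) = E d" for d
    by (auto simp: E_def)
  have int: "integrable (cond_law S i) (indicator (E d) :: 'w \<Rightarrow> real)" for d
    by (rule integrable_real_indicator[OF E]) (simp add: P.emeasure_eq_measure)
  note ws = wald_identity_sensor[OF i _ fin(1) fin(2) integrable_log_ratio[OF i]]
  have AE: "AE \<omega> in cond_law S i. (\<Sum>l\<in>sensors S. \<Sum>n. ?\<xi> l n \<omega>)
      = indicator (E 0) \<omega> * a + indicator (E 1) \<omega> * b"
    using fin(2) exact AE_space
  proof eventually_elim
    case (elim \<omega>)
    then obtain k where k: "stop_time S p \<omega> = enat k" by auto
    have \<omega>: "\<omega> \<in> space (law S)" using elim by simp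
    have "stopped_llr \<omega> = llr S p k \<omega>" by (simp add: stopped_llr_def k)
    then show ?case
      using stopped_llr_eq[OF \<omega> elim(1)] decision_cases[OF \<omega>] elim(2) k \<omega> by (auto simp: indicator_def E_def)
  qed
  have "(\<Sum>l\<in>sensors S. enn2real (cond_usage i l) * (\<integral>x. log_ratio l x \<partial>sample_law S i l))
      = (\<Sum>l\<in>sensors S. \<integral>\<omega>. (\<Sum>n. ?\<xi> l n \<omega>) \<partial>cond_law S i)"
    by (rule sum.cong) (use ws(2) in auto)
  also have "\<dots> = (\<integral>\<omega>. (\<Sum>l\<in>sensors S. \<Sum>n. ?\<xi> l n \<omega>) \<partial>cond_law S i)"
    by (rule Bochner_Integration.integral_sum[symmetric]) (use ws(1) in auto)
  also have "\<dots> = (\<integral>\<omega>. indicator (E 0) \<omega> * a + indicator (E 1) \<omega> * b \<partial>cond_law S i)"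
  proof (rule integral_cong_AE[OF _ _ AE])
    show "(\<lambda>\<omega>. \<Sum>l\<in>sensors S. \<Sum>n. ?\<xi> l n \<omega>) \<in> borel_measurable (cond_law S i)"
      by (rule borel_measurable_sum) (use ws(1) in auto)
  qed measurable
  also have "\<dots> = P.prob (E 0) * a + P.prob (E 1) * b"
    using int by simp
  also have "\<dots> = decide_prob S p i 0 * a + decide_prob S p i 1 * b"
    by (simp add: decide_prob_def E_def)
  finally show ?thesis by simp
qed

section \<open>Nonnegative divergences and consequences of a finite expected time\<close>

lemma kl_nonneg:
  assumes l: "l \<in> sensors S"
  shows "0 \<le> kl0 S l" "0 \<le> kl1 S l"
proof -
  interpret base: sigma_finite_measure "base S" by (rule sigma_finite_base)
  \<comment> \<open>Gibbs' inequality for an ordered pair of hypotheses, to be used in both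
    directions. Base \<open>exp 1\<close> turns the logarithm of \<open>KL_divergence\<close> into
    \<open>ln\<close>.\<close>
  have kl: "0 \<le> (\<integral>x. ln (dens S j l x / dens S i l x) \<partial>sample_law S j l)"
    if ij: "i \<in> {0, 1}" "j \<in> {0, 1}"
      and ac: "AE x in base S. dens S i l x = 0 \<longrightarrow> dens S j l x = 0"
      and int: "integrable (sample_law S j l) (\<lambda>x. ln (dens S j l x / dens S i l x))" for i j
  proof -
    have [measurable]: "dens S i l \<in> borel_measurable (base S)" "dens S j l \<in> borel_measurable (base S)"
      using measurable_dens l ij by auto
    have nn: "AE x in base S. 0 \<le> dens S i l x" "AE x in base S. 0 \<le> dens S j l x"
      using dens_nonneg l ij by auto
    have "integrable (base S) (\<lambda>x. dens S j l x * log (exp 1) (dens S j l x / dens S i l x))"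
      using int nn unfolding sample_law_def by (subst (asm) integrable_real_density) (auto simp: log_def)
    then have "0 \<le> KL_divergence (exp 1) (density (base S) (dens S i l)) (density (base S) (dens S j l))"
      using prob_space_sample_law[OF ij(1) l] prob_space_sample_law[OF ij(2) l]
      unfolding sample_law_def
      by (intro base.KL_density_density_nonneg nn ac) auto
    also have "\<dots> = (\<integral>x. dens S j l x * log (exp 1) (dens S j l x / dens S i l x) \<partial>base S)"
      by (rule base.KL_density_density) (use nn ac in auto)
    also have "\<dots> = (\<integral>x. ln (dens S j l x / dens S i l x) \<partial>sample_law S j l)"
      unfolding sample_law_def by (subst integral_real_density) (use nn in \<open>auto simp: log_def\<close>)
    finally show ?thesis .
  qed
  have ac: "AE x in base S. dens S 0 l x = 0 \<longleftrightarrow> dens S 1 l x = 0"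
    using finite_kl l by (auto simp: finite_divergences_def)
  show "0 \<le> kl0 S l" "0 \<le> kl1 S l"
    unfolding kl0_def kl1_def
    by (intro kl; use finite_kl l ac in \<open>auto simp: finite_divergences_def\<close>)+
qed

text \<open>The usage is a mixture of the two conditional usages with positive weights and is
  bounded by the expected time, so both components are finite.\<close>

lemma finite_usage:
  assumes i: "i \<in> {0, 1}" and l: "l \<in> sensors S" and fin: "expected_time S p < \<infinity>"
  shows "cond_usage i l < \<infinity>"
proof -
  have "expected_usage S p l \<le> expected_time S p"
    unfolding expected_time_eq using l by (intro member_le_sum) auto
  with fin have "expected_usage S p l < \<infinity>" by simp
  then show ?thesis
    using i prior_pos[of 0] prior_pos[of 1]
    by (auto simp: expected_usage_eq ennreal_mult_less_top less_top)
qed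

lemma AE_stop_time_finite:
  assumes "expected_time S p < \<infinity>"
  shows "AE \<omega> in law S. stop_time S p \<omega> < \<infinity>"
proof -
  have "(\<lambda>\<omega>. \<Sum>n. of_bool (enat n < stop_time S p \<omega>) :: ennreal) \<in> borel_measurable (law S)"
    unfolding less_stop_time_iff of_bool_def by measurable
  then have "AE \<omega> in law S. ennreal_of_enat (stop_time S p \<omega>) \<noteq> \<infinity>"
    using assms by (intro nn_integral_PInf_AE) (auto simp: suminf_of_bool_less_enat expected_time_def)
  then show ?thesis
    by eventually_elim (metis enat_ord_simps(4) ennreal_of_enat_infty)
qed

end

section \<open>Real identities and estimates for thresholds and quotients\<close>

text \<open>For \<open>\<alpha> \<in> {0, 1}\<close> both divergences are \<open>0\<close> thanks to \<open>0 * ln (0 / 0) = 0\<close>.\<close>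

lemma binary_kl_wald:
  assumes "0 \<le> \<alpha>" "\<alpha> \<le> 1" and B: "1 - \<beta> = exp B * \<alpha>" and A: "\<beta> = exp (- A) * (1 - \<alpha>)"
  shows "binary_kl (1 - \<beta>) \<alpha> = \<beta> * (- A) + (1 - \<beta>) * B"
    and "binary_kl \<alpha> (1 - \<beta>) = - ((1 - \<alpha>) * (- A) + \<alpha> * B)"
proof -
  consider "\<alpha> = 0" | "\<alpha> = 1" | "0 < \<alpha>" "\<alpha> < 1" using assms by linarith
  then have "binary_kl (1 - \<beta>) \<alpha> = \<beta> * (- A) + (1 - \<beta>) * B \<and>
      binary_kl \<alpha> (1 - \<beta>) = - ((1 - \<alpha>) * (- A) + \<alpha> * B)"
  proof cases
    case 3
    have "(1 - \<beta>) / \<alpha> = exp B" "\<alpha> / (1 - \<beta>) = exp (- B)"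
      using 3 unfolding B by (auto simp: exp_minus field_simps)
    moreover have "\<beta> / (1 - \<alpha>) = exp (- A)" "(1 - \<alpha>) / \<beta> = exp A"
      using 3 unfolding A by (auto simp: exp_minus divide_simps)
    ultimately show ?thesis by (simp add: binary_kl_def)
  qed (use A B in \<open>auto simp: binary_kl_def\<close>)
  then show "binary_kl (1 - \<beta>) \<alpha> = \<beta> * (- A) + (1 - \<beta>) * B"
    and "binary_kl \<alpha> (1 - \<beta>) = - ((1 - \<alpha>) * (- A) + \<alpha> * B)" by auto
qed

text \<open>If all divergences in \<open>R\<close> vanish, then \<open>M = 0\<close> and every quotient is \<open>0\<close>.\<close>

lemma sum_divide_Max_le:
  fixes k N :: "nat \<Rightarrow> real"
  assumes fin: "finite R" "finite C" and "R \<noteq> {}"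
    and nonneg: "\<And>l. l \<in> R \<union> C \<Longrightarrow> 0 \<le> k l" "\<And>l. l \<in> R \<union> C \<Longrightarrow> 0 \<le> N l"
  defines "M \<equiv> Max (k ` R)"
  shows "((\<Sum>l\<in>R. N l * k l) + (\<Sum>l\<in>C. N l * k l)) / M \<le> (\<Sum>l\<in>R. N l) + (\<Sum>l\<in>C. N l * (k l / M))"
proof -
  have le: "k l \<le> M" if "l \<in> R" for l
    unfolding M_def using fin that by (intro Max_ge) auto
  obtain l0 where "l0 \<in> R" using \<open>R \<noteq> {}\<close> by auto
  with le nonneg(1) have M: "0 \<le> M" by (meson UnI1 order_trans)
  have "N l * k l / M \<le> N l" if "l \<in> R" for l
  proof (cases "M = 0")
    case False
    then have "k l / M \<le> 1" using le[OF that] M by simp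
    then show ?thesis using mult_left_mono[of "k l / M" 1 "N l"] nonneg(2) that by simp
  qed (use nonneg that in auto)
  then have "(\<Sum>l\<in>R. N l * k l / M) \<le> (\<Sum>l\<in>R. N l)" by (rule sum_mono)
  then show ?thesis by (simp add: add_divide_distrib sum_divide_distrib)
qed

section \<open>The lower bound on the expected sample size\<close>

theorem proposition1:
  fixes S :: "('w, 'a) sensing" and p :: "'a procedure"
    and \<Omega> :: "nat set" and Tlim lam :: "nat \<Rightarrow> real"
    and \<alpha> \<beta> \<mu>0 \<mu>1 A B :: real and \<psi> :: "real \<Rightarrow> nat"
  assumes "sensing_model S" and "finite_divergences S"
    and "\<Omega> \<subseteq> sensors S" and "\<forall>l\<in>\<Omega>. 0 < Tlim l"
    and "constrained_optimal S \<alpha> \<beta> \<Omega> Tlim p"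
    and "lagrangian_optimal S \<alpha> \<beta> \<Omega> Tlim \<mu>0 \<mu>1 lam p"
    and "threshold_form S \<psi> A B p"
    and "wald_approximation S A B p"
    and "sensors S - effective_set \<Omega> lam \<noteq> {}"
  shows "ereal (
      prior S 0 * (binary_kl \<alpha> (1 - \<beta>) / Max (kl0 S ` (sensors S - effective_set \<Omega> lam)))
    + prior S 1 * (binary_kl (1 - \<beta>) \<alpha> / Max (kl1 S ` (sensors S - effective_set \<Omega> lam)))
    - (\<Sum>l\<in>effective_set \<Omega> lam.
         (max (kl1 S l / Max (kl1 S ` (sensors S - effective_set \<Omega> lam)))
              (kl0 S l / Max (kl0 S ` (sensors S - effective_set \<Omega> lam))) - 1) * Tlim l))
    \<le> enn2ereal (expected_time S p)"
proof (cases "expected_time S p < \<infinity>")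
  \<comment> \<open>An infinite expected time exceeds every real bound. In the other case all usages
    are finite and stopping is almost sure, as Wald's identity requires.\<close>
  case False
  then have "expected_time S p = top" by (simp add: less_top[symmetric])
  then show ?thesis by (simp add: top_ennreal.rep_eq)
next
  case fin: True
  interpret sensing_procedure_finite_kl S p
    by standard (use assms in \<open>auto simp: lagrangian_optimal_def\<close>)
  let ?C = "effective_set \<Omega> lam"
  let ?R = "sensors S - ?C"
  let ?M0 = "Max (kl0 S ` ?R)" and ?M1 = "Max (kl1 S ` ?R)"
  define N where "N i l = enn2real (cond_usage i l)" for i l
  have C: "?C \<subseteq> sensors S" "finite ?C"
    using assms(3) by (auto simp: effective_set_def intro: finite_subset[OF _ finite_sensors])
  have N0: "0 \<le> N i l" for i l by (simp add: N_def)
  have cu: "cond_usage i l = ennreal (N i l)" if "i \<in> {0, 1}" "l \<in> sensors S" for i l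
    using finite_usage[OF that fin] by (simp add: N_def)
  have prior: "0 < prior S 0" "0 < prior S 1" using prior_pos by auto
  have usage: "expected_usage S p l = ennreal (prior S 0 * N 0 l + prior S 1 * N 1 l)" if "l \<in> sensors S" for l
    using prior N0 by (simp add: expected_usage_eq cu that ennreal_mult' ennreal_plus)
  have time: "expected_time S p = ennreal (\<Sum>l\<in>sensors S. prior S 0 * N 0 l + prior S 1 * N 1 l)"
    unfolding expected_time_eq using prior N0 by (subst sum_ennreal[symmetric]) (auto simp: usage)
  \<comment> \<open>On the effective set the usage constraint is an equality. Positivity of
    \<open>Tlim l\<close> makes it faithful to its image under \<open>ennreal\<close>.\<close>
  have Tlim: "Tlim l = prior S 0 * N 0 l + prior S 1 * N 1 l" if "l \<in> ?C" for l
  proof -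
    have "ennreal (prior S 0 * N 0 l + prior S 1 * N 1 l) = ennreal (Tlim l)" "0 < Tlim l"
      using that C assms(4,6) usage[of l] by (auto simp: lagrangian_optimal_def effective_set_def)
    then show ?thesis using prior N0 by (subst (asm) ennreal_inj) auto
  qed
  have stop: "AE \<omega> in cond_law S i. stop_time S p \<omega> < \<infinity>" if "i \<in> {0, 1}" for i
    by (rule AE_cond_law[OF that AE_stop_time_finite[OF fin]])
  have exact: "AE \<omega> in cond_law S i. \<forall>n. stop_time S p \<omega> = enat n \<longrightarrow>
        (decision S p \<omega> = 0 \<longrightarrow> llr S p n \<omega> = - A) \<and> (decision S p \<omega> = 1 \<longrightarrow> llr S p n \<omega> = B)"
    if "i \<in> {0, 1}" for i
    using assms(8) unfolding wald_approximation_def by (rule AE_cond_law[OF that])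
  have dp: "decide_prob S p 0 1 = \<alpha>" "decide_prob S p 1 0 = \<beta>"
    using assms(6) by (auto simp: lagrangian_optimal_def)
  have dp': "decide_prob S p 0 0 = 1 - \<alpha>" "decide_prob S p 1 1 = 1 - \<beta>"
    using decide_prob_sum[OF _ stop, of 0] decide_prob_sum[OF _ stop, of 1] dp by auto
  have "AE \<omega> in cond_law S 0. \<forall>n. stop_time S p \<omega> = enat n \<and> decision S p \<omega> = 1 \<longrightarrow> llr S p n \<omega> = B"
    using exact[OF insertI1] by eventually_elim blast
  from decide_prob_change[OF this] have B: "1 - \<beta> = exp B * \<alpha>"
    by (simp only: dp dp')
  have "AE \<omega> in cond_law S 0. \<forall>n. stop_time S p \<omega> = enat n \<and> decision S p \<omega> = 0 \<longrightarrow> llr S p n \<omega> = - A"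
    using exact[OF insertI1] by eventually_elim blast
  from decide_prob_change[OF this] have A: "\<beta> = exp (- A) * (1 - \<alpha>)"
    by (simp only: dp dp')
  \<comment> \<open>The range of \<open>\<alpha>\<close> follows because \<open>\<alpha>\<close> and
    \<open>1 - \<alpha>\<close> are both decision probabilities under hypothesis
    \<open>0\<close>.\<close>
  have "0 \<le> decide_prob S p 0 1" "0 \<le> decide_prob S p 0 0"
    by (simp_all add: decide_prob_def)
  then have "0 \<le> \<alpha>" "\<alpha> \<le> 1"
    unfolding dp dp' by simp_all
  note kl = binary_kl_wald[OF this B A]
  \<comment> \<open>Under hypothesis \<open>0\<close> a sample of sensor \<open>l\<close> moves the
    log-likelihood ratio by \<open>- kl0 S l\<close> on average; this is the source of the minus
    sign.\<close>
  have "decide_prob S p 0 0 * (- A) + decide_prob S p 0 1 * B = - (\<Sum>l\<in>sensors S. N 0 l * kl0 S l)"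
    by (subst wald_identity[OF _ finite_usage[OF _ _ fin] stop exact])
       (auto simp: kl_log_ratio N_def sum_negf)
  then have E0: "binary_kl \<alpha> (1 - \<beta>) = (\<Sum>l\<in>sensors S. N 0 l * kl0 S l)"
    unfolding kl dp dp' by simp
  have "decide_prob S p 1 0 * (- A) + decide_prob S p 1 1 * B = (\<Sum>l\<in>sensors S. N 1 l * kl1 S l)"
    by (subst wald_identity[OF _ finite_usage[OF _ _ fin] stop exact])
       (auto simp: kl_log_ratio N_def)
  then have E1: "binary_kl (1 - \<beta>) \<alpha> = (\<Sum>l\<in>sensors S. N 1 l * kl1 S l)"
    unfolding kl dp dp' .
  have split: "(\<Sum>l\<in>sensors S. f l) = (\<Sum>l\<in>?R. f l) + (\<Sum>l\<in>?C. f l)" for f :: "nat \<Rightarrow> real"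
    by (rule sum.subset_diff[OF C(1)]) simp
  have b0: "binary_kl \<alpha> (1 - \<beta>) / ?M0 \<le> (\<Sum>l\<in>?R. N 0 l) + (\<Sum>l\<in>?C. N 0 l * (kl0 S l / ?M0))"
    unfolding E0 split by (rule sum_divide_Max_le) (use assms(9) C N0 kl_nonneg in auto)
  have b1: "binary_kl (1 - \<beta>) \<alpha> / ?M1 \<le> (\<Sum>l\<in>?R. N 1 l) + (\<Sum>l\<in>?C. N 1 l * (kl1 S l / ?M1))"
    unfolding E1 split by (rule sum_divide_Max_le) (use assms(9) C N0 kl_nonneg in auto)
  \<comment> \<open>Only the prior mixture of the two conditional usages is known, namely
    \<open>Tlim l\<close>. Bounding both quotients by one coefficient lets the mixture be
    formed.\<close>
  define r where "r l = max (kl1 S l / ?M1) (kl0 S l / ?M0)" for l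
  have "prior S 0 * (N 0 l * (kl0 S l / ?M0)) + prior S 1 * (N 1 l * (kl1 S l / ?M1)) \<le> r l * Tlim l"
    if "l \<in> ?C" for l
  proof -
    have "(prior S 0 * N 0 l) * (kl0 S l / ?M0) \<le> (prior S 0 * N 0 l) * r l"
      "(prior S 1 * N 1 l) * (kl1 S l / ?M1) \<le> (prior S 1 * N 1 l) * r l"
      by (rule mult_left_mono; use prior N0 in \<open>simp add: r_def\<close>)+
    then show ?thesis unfolding Tlim[OF that] by (simp add: algebra_simps)
  qed
  then have "(\<Sum>l\<in>?C. prior S 0 * (N 0 l * (kl0 S l / ?M0)) + prior S 1 * (N 1 l * (kl1 S l / ?M1)))
      \<le> (\<Sum>l\<in>?C. r l * Tlim l)"
    by (rule sum_mono)
  moreover have "prior S 0 * (binary_kl \<alpha> (1 - \<beta>) / ?M0) + prior S 1 * (binary_kl (1 - \<beta>) \<alpha> / ?M1)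
      \<le> prior S 0 * ((\<Sum>l\<in>?R. N 0 l) + (\<Sum>l\<in>?C. N 0 l * (kl0 S l / ?M0)))
        + prior S 1 * ((\<Sum>l\<in>?R. N 1 l) + (\<Sum>l\<in>?C. N 1 l * (kl1 S l / ?M1)))"
    using b0 b1 prior by (intro add_mono mult_left_mono) auto
  \<comment> \<open>The \<open>- 1\<close> in each coefficient restores the usage of the effective
    sensors, which completes the sums over \<open>?R\<close> to the total expected time.\<close>
  moreover have "(\<Sum>l\<in>?C. (r l - 1) * Tlim l) = (\<Sum>l\<in>?C. r l * Tlim l) - (\<Sum>l\<in>?C. prior S 0 * N 0 l + prior S 1 * N 1 l)"
    by (simp add: left_diff_distrib sum_subtractf Tlim)
  ultimately have "prior S 0 * (binary_kl \<alpha> (1 - \<beta>) / ?M0) + prior S 1 * (binary_kl (1 - \<beta>) \<alpha> / ?M1)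
      - (\<Sum>l\<in>?C. (r l - 1) * Tlim l) \<le> (\<Sum>l\<in>sensors S. prior S 0 * N 0 l + prior S 1 * N 1 l)"
    unfolding split by (simp add: distrib_left sum.distrib sum_distrib_left)
  \<comment> \<open>Nonnegativity lets the \<open>ennreal\<close> value of the expected time be read
    as this real number in \<open>ereal\<close>.\<close>
  moreover have "0 \<le> (\<Sum>l\<in>sensors S. prior S 0 * N 0 l + prior S 1 * N 1 l)"
    using prior N0 by (intro sum_nonneg) simp
  ultimately show ?thesis
    by (simp add: time r_def enn2ereal_ennreal)
qed

end
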